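(* Let $V:[0,\infty)\to\mathbb{R}$ be a càdlàg function with finite variation on every compact interval, and fix $t>0$. Then for Lebesgue-almost every $x\in\mathbb{R}$ the sets $(0,t]\cap\mathcal{I}(x)$ and $(0,t]\cap\mathcal{D}(x)$ are finite, so that $\ell^x(t)$ and $\lambda^x(t)$ are well defined. The functions $x\mapsto \ell^x(t)$ and $x\mapsto\lambda^x(t)$ are measurable and Lebesgue integrable, and for every Borel set $A\subseteq\mathbb{R}$, $$\theta_t(A)=\int_A \ell^x(t)\,{\rm d}x,\qquad \vartheta_t(A)=\int_A \lambda^x(t)\,{\rm d}x .$$ That is, $\theta_t({\rm d}x)=\ell^x(t)\,{\rm d}x$ and $\vartheta_t({\rm d}x)=\lambda^x(t)\,{\rm d}x$.
   Context: Let $V:[0,\infty)\to\mathbb{R}$ be càdlàg (right-continuous with left limits) with finite variation on compact intervals. Write $V(s-)$ for the left limit and $\Delta V(s)=V(s)-V(s-)$. The discontinuous part is $V^d(t)=\sum_{0<s\le t}\Delta V(s)$ (an absolutely convergent series), and the continuous part is $V^c=V-V^d$. Then $V^c$ is continuous with finite variation. $V^c({\rm d}s)$ denotes its signed Stieltjes measure and $|V^c({\rm d}s)|$ its total variation measure. For $t>0$ and Borel $A\subseteq\mathbb{R}$ define the signed occupation measure $\theta_t(A)=\int_0^t \mathbf{1}_A(V(s))\,V^c({\rm d}s)$ and the absolute occupation measure $\vartheta_t(A)=\int_0^t\mathbf{1}_A(V(s))\,|V^c({\rm d}s)|$. For $x\in\mathbb{R}$ and $t>0$, we say $V$ increases through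 level $x$ at time $t$, and write $t\in\mathcal{I}(x)$, if two conditions hold. First, $V(t)=x$ and $V$ is continuous at $t$. Second, there is $\delta>0$ such that for all $s\ge0$ with $0<|s-t|<\delta$, $V(s)-V(t)$ has the same (strict) sign as $s-t$. We say $V$ decreases through level $x$ at time $t$, written $t\in\mathcal{D}(x)$, if $-V$ increases through level $-x$ at time $t$. Define $\ell^x(t)=\mathrm{Card}((0,t]\cap\mathcal{I}(x))-\mathrm{Card}((0,t]\cap\mathcal{D}(x))$ and $\lambda^x(t)=\mathrm{Card}((0,t]\cap\mathcal{I}(x))+\mathrm{Card}((0,t]\cap\mathcal{D}(x))$, whenever these cardinalities are finite. *)

theory Defs
  imports "HOL-Analysis.Analysis"
begin

text \<open>Paths V : [0,\<infinity>) \<rightarrow> \<real> are represented as functions real \<Rightarrow> real; only values on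
  [0,\<infinity>) are ever used by the definitions below.\<close>

definition partition_sum :: "(real \<Rightarrow> real) \<Rightarrow> real list \<Rightarrow> real" where
  "partition_sum f xs = (\<Sum>i<length xs - 1. \<bar>f (xs ! Suc i) - f (xs ! i)\<bar>)"

definition partition_sums :: "(real \<Rightarrow> real) \<Rightarrow> real \<Rightarrow> real \<Rightarrow> real set" where
  "partition_sums f a b = partition_sum f ` {xs. sorted xs \<and> set xs \<subseteq> {a..b}}"

definition bounded_variation_on :: "(real \<Rightarrow> real) \<Rightarrow> real \<Rightarrow> real \<Rightarrow> bool" where
  "bounded_variation_on f a b \<longleftrightarrow> bdd_above (partition_sums f a b)"

definition variation :: "(real \<Rightarrow> real) \<Rightarrow> real \<Rightarrow> real \<Rightarrow> real" where
  "variation f a b = Sup (partition_sums f a b)"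

definition cadlag :: "(real \<Rightarrow> real) \<Rightarrow> bool" where
  "cadlag V \<longleftrightarrow> (\<forall>s\<ge>0. continuous (at_right s) V) \<and> (\<forall>s>0. \<exists>l. (V \<longlongrightarrow> l) (at_left s))"

definition left_lim :: "(real \<Rightarrow> real) \<Rightarrow> real \<Rightarrow> real" where
  "left_lim V s = Lim (at_left s) V"

definition jump :: "(real \<Rightarrow> real) \<Rightarrow> real \<Rightarrow> real" where
  "jump V s = V s - left_lim V s"

definition disc_part :: "(real \<Rightarrow> real) \<Rightarrow> real \<Rightarrow> real" where
  "disc_part V t = (\<Sum>\<^sub>\<infinity>s\<in>{0<..t}. jump V s)"

definition cont_part :: "(real \<Rightarrow> real) \<Rightarrow> real \<Rightarrow> real" where
  "cont_part V t = V t - disc_part V t"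

text \<open>Total variation function of V^c on [0,s] (extended constantly to s<0), and the
  Jordan decomposition V^c = P - N into nondecreasing continuous functions.\<close>
definition tv_cont :: "(real \<Rightarrow> real) \<Rightarrow> real \<Rightarrow> real" where
  "tv_cont V s = variation (cont_part V) 0 (max 0 s)"

definition pos_var :: "(real \<Rightarrow> real) \<Rightarrow> real \<Rightarrow> real" where
  "pos_var V s = (tv_cont V s + cont_part V (max 0 s)) / 2"

definition neg_var :: "(real \<Rightarrow> real) \<Rightarrow> real \<Rightarrow> real" where
  "neg_var V s = (tv_cont V s - cont_part V (max 0 s)) / 2"

text \<open>Signed occupation measure theta_t(A) = \<integral>_0^t 1_A(V s) V^c(ds)
  (signed Stieltjes measure of V^c = mu_P - mu_N), and absolute occupation measure
  vartheta_t(A) = \<integral>_0^t 1_A(V s) |V^c(ds)| (mu of the total variation function).\<close>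
definition occ_set :: "(real \<Rightarrow> real) \<Rightarrow> real \<Rightarrow> real set \<Rightarrow> real set" where
  "occ_set V t A = {s\<in>{0<..t}. V s \<in> A}"

definition theta :: "(real \<Rightarrow> real) \<Rightarrow> real \<Rightarrow> real set \<Rightarrow> real" where
  "theta V t A = measure (interval_measure (pos_var V)) (occ_set V t A)
               - measure (interval_measure (neg_var V)) (occ_set V t A)"

definition vartheta :: "(real \<Rightarrow> real) \<Rightarrow> real \<Rightarrow> real set \<Rightarrow> real" where
  "vartheta V t A = measure (interval_measure (tv_cont V)) (occ_set V t A)"

definition incr_through :: "(real \<Rightarrow> real) \<Rightarrow> real \<Rightarrow> real \<Rightarrow> bool" where
  "incr_through V x t \<longleftrightarrow> t > 0 \<and> V t = x \<and> isCont V t \<and>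
     (\<exists>\<delta>>0. \<forall>s\<ge>0. 0 < \<bar>s - t\<bar> \<and> \<bar>s - t\<bar> < \<delta> \<longrightarrow> sgn (V s - V t) = sgn (s - t))"

definition decr_through :: "(real \<Rightarrow> real) \<Rightarrow> real \<Rightarrow> real \<Rightarrow> bool" where
  "decr_through V x t \<longleftrightarrow> incr_through (\<lambda>s. - V s) (- x) t"

definition incr_times :: "(real \<Rightarrow> real) \<Rightarrow> real \<Rightarrow> real \<Rightarrow> real set" where
  "incr_times V t x = {0<..t} \<inter> {s. incr_through V x s}"

definition decr_times :: "(real \<Rightarrow> real) \<Rightarrow> real \<Rightarrow> real \<Rightarrow> real set" where
  "decr_times V t x = {0<..t} \<inter> {s. decr_through V x s}"

text \<open>ell^x(t) and lambda^x(t) (card is 0 for infinite sets; they are only meaningful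
  where the sets are finite, which the theorem shows holds a.e.).\<close>
definition ell :: "(real \<Rightarrow> real) \<Rightarrow> real \<Rightarrow> real \<Rightarrow> int" where
  "ell V t x = int (card (incr_times V t x)) - int (card (decr_times V t x))"

definition lam :: "(real \<Rightarrow> real) \<Rightarrow> real \<Rightarrow> real \<Rightarrow> nat" where
  "lam V t x = card (incr_times V t x) + card (decr_times V t x)"

end

theory Submission
  imports Defs
begin

text \<open>
  Counting the sign changes of \<open>V - x\<close> along dyadic partitions of \<open>(a, b]\<close> and integrating over the
  level \<open>x\<close> gives the positive and negative parts of the increments of \<open>V\<close> over the partition, which
  are bounded by the variation. Hence for almost every \<open>x\<close> the number of sign changes stabilizes. If
  moreover \<open>x\<close> avoids the countably many local extremal values and one-sided limits at jumps, then every
  sign change is due either to a time in \<open>I(x)\<close> or \<open>D(x)\<close> or to a jump across \<open>x\<close>. In the limit,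
  \<open>\<integral> Card (I(x) \<inter> (a, b]) dx\<close> is the limit of the sums of positive increments minus the sum of the
  positive jumps, and similarly for \<open>D\<close>. The difference of the two is therefore the increment of \<open>V\<^sup>c\<close>.
  Their sum is the variation of \<open>V\<^sup>c\<close>: it dominates \<open>|V\<^sup>c(b) - V\<^sup>c(a)|\<close> on every interval, and
  conversely \<open>V\<^sup>c\<close> varies along a partition by at least the variation of \<open>V\<close> minus the sum of the
  absolute jumps. So the Stieltjes measures of the Jordan decomposition of \<open>V\<^sup>c\<close> are
  \<open>B \<mapsto> \<integral> Card (I(x) \<inter> B) dx\<close> and \<open>B \<mapsto> \<integral> Card (D(x) \<inter> B) dx\<close> on intervals, hence on all Borel sets,
  and evaluating them at \<open>V\<^sup>-\<^sup>1(A)\<close> gives the theorem.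
\<close>

subsection \<open>Dyadic grids\<close>

definition grid :: "real \<Rightarrow> real \<Rightarrow> nat \<Rightarrow> nat \<Rightarrow> real" where
  "grid a b n k = a + (b - a) * real k / 2 ^ n"

definition dyadic_points :: "real \<Rightarrow> real \<Rightarrow> real set" where
  "dyadic_points a b = {grid a b n k | n k. k \<le> 2 ^ n}"

lemma grid_0 [simp]: "grid a b n 0 = a"
  by (simp add: grid_def)

lemma grid_top [simp]: "grid a b n (2 ^ n) = b"
  by (simp add: grid_def)

lemma grid_Suc: "grid a b n (Suc k) = grid a b n k + (b - a) / 2 ^ n"
  by (simp add: grid_def field_simps)

lemma grid_refine: "grid a b (n + j) (k * 2 ^ j) = grid a b n k"
  by (simp add: grid_def power_add)

lemma grid_less_iff: "a < b \<Longrightarrow> grid a b n i < grid a b n j \<longleftrightarrow> i < j"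
  by (simp add: grid_def divide_less_cancel)

lemma grid_le_iff: "a < b \<Longrightarrow> grid a b n i \<le> grid a b n j \<longleftrightarrow> i \<le> j"
  by (simp add: grid_def divide_le_cancel)

lemma grid_ge: "a \<le> b \<Longrightarrow> a \<le> grid a b n k"
  by (simp add: grid_def)

lemma grid_le: "a \<le> b \<Longrightarrow> k \<le> 2 ^ n \<Longrightarrow> grid a b n k \<le> b"
  using mult_left_mono[of "real k / 2 ^ n" 1 "b - a"]
  by (simp add: grid_def divide_le_eq_1)

lemma grid_in_dyadic_points: "k \<le> 2 ^ n \<Longrightarrow> grid a b n k \<in> dyadic_points a b"
  by (auto simp: dyadic_points_def)

lemma countable_dyadic_points: "countable (dyadic_points a b)"
proof -
  have "dyadic_points a b \<subseteq> (\<lambda>(n, k). grid a b n k) ` UNIV"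
    by (auto simp: dyadic_points_def)
  then show ?thesis
    by (rule countable_subset) simp
qed

text \<open>The least index whose grid point reaches \<open>s\<close> is positive because
  \<open>a < s\<close>; its predecessor bounds the cell on the left. Cells are half-open on the left
  like \<open>(a, b]\<close>, so a jump at a grid point belongs to the cell ending there.\<close>

lemma grid_cell:
  assumes "a < b" "a < s" "s \<le> b"
  obtains k where "k < 2 ^ n" "grid a b n k < s" "s \<le> grid a b n (Suc k)"
proof -
  define P where "P k \<longleftrightarrow> s \<le> grid a b n k" for k
  have "P (2 ^ n)" "\<not> P 0"
    using assms by (auto simp: P_def)
  then obtain k where k: "\<not> P k" "P (Suc k)" "k < 2 ^ n"
    using ex_least_nat_less[of P "2 ^ n"] by auto
  then show ?thesis
    using that[of k] by (auto simp: P_def)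
qed

lemma mesh_tendsto_0: "(\<lambda>n. (b - a) / 2 ^ n :: real) \<longlonglongrightarrow> 0"
  using LIMSEQ_divide_realpow_zero[of 2 "b - a"] by simp

lemma dyadic_points_dense:
  assumes "a \<le> u" "u < w" "w \<le> b"
  obtains d where "d \<in> dyadic_points a b" "u < d" "d < w"
proof -
  have ab: "a < b" using assms by simp
  have "\<forall>\<^sub>F n in sequentially. (b - a) / 2 ^ n < w - u"
    using assms by (intro order_tendstoD(2)[OF mesh_tendsto_0]) auto
  then obtain n where n: "(b - a) / 2 ^ n < w - u"
    by (auto simp: eventually_sequentially)
  obtain k where k: "k < 2 ^ n" "grid a b n k < w" "w \<le> grid a b n (Suc k)"
    using grid_cell[of a b w n] assms by auto
  then have "u < grid a b n k"
    using n by (simp add: grid_Suc)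
  then show ?thesis
    using that[of "grid a b n k"] k grid_in_dyadic_points[of k n a b] by auto
qed

lemma dyadic_points_common_level:
  assumes "d \<in> dyadic_points a b" "d' \<in> dyadic_points a b"
  obtains m i i' where "m \<ge> n" "i \<le> 2 ^ m" "i' \<le> 2 ^ m" "d = grid a b m i" "d' = grid a b m i'"
proof -
  obtain p k p' k' where *: "d = grid a b p k" "k \<le> 2 ^ p" "d' = grid a b p' k'" "k' \<le> 2 ^ p'"
    using assms by (auto simp: dyadic_points_def)
  show ?thesis
  proof (rule that)
    show "n + p + p' \<ge> n" by simp
    show "d = grid a b (n + p + p') (k * 2 ^ (n + p'))"
      using grid_refine[of a b p "n + p'" k] * by (simp add: ac_simps)
    show "d' = grid a b (n + p + p') (k' * 2 ^ (n + p))"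
      using grid_refine[of a b p' "n + p" k'] * by (simp add: ac_simps)
    have "k * 2 ^ (n + p') \<le> 2 ^ p * 2 ^ (n + p')" "k' * 2 ^ (n + p) \<le> 2 ^ p' * 2 ^ (n + p)"
      using * by (intro mult_right_mono; simp)+
    then show "k * 2 ^ (n + p') \<le> 2 ^ (n + p + p')" "k' * 2 ^ (n + p) \<le> 2 ^ (n + p + p')"
      by (simp_all add: power_add ac_simps)
  qed
qed

section \<open>Sign changes along refining grids\<close>

definition grid_variation :: "(real \<Rightarrow> int) \<Rightarrow> real \<Rightarrow> real \<Rightarrow> nat \<Rightarrow> int" where
  "grid_variation f a b n = (\<Sum>k<2 ^ n. \<bar>f (grid a b n (Suc k)) - f (grid a b n k)\<bar>)"

lemma abs_diff_le_sum:
  fixes f :: "nat \<Rightarrow> 'a :: linordered_idom"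
  assumes "i \<le> j"
  shows "\<bar>f j - f i\<bar> \<le> (\<Sum>k=i..<j. \<bar>f (Suc k) - f k\<bar>)"
proof -
  have "f j - f i = (\<Sum>k=i..<j. f (Suc k) - f k)"
    using sum_Suc_diff'[OF assms, of f] by simp
  then show ?thesis
    by (simp only: sum_abs)
qed

lemma grid_variation_blocks:
  "grid_variation f a b (n + j) =
    (\<Sum>k<2 ^ n. \<Sum>i = k * 2 ^ j..<k * 2 ^ j + 2 ^ j.
       \<bar>f (grid a b (n + j) (Suc i)) - f (grid a b (n + j) i)\<bar>)"
  unfolding grid_variation_def sum.nat_group by (simp add: power_add)

lemma grid_variation_block_ge:
  "\<bar>f (grid a b n (Suc k)) - f (grid a b n k)\<bar> \<le>
    (\<Sum>i = k * 2 ^ j..<k * 2 ^ j + 2 ^ j. \<bar>f (grid a b (n + j) (Suc i)) - f (grid a b (n + j) i)\<bar>)"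
  for f :: "real \<Rightarrow> int"
  using abs_diff_le_sum[of "k * 2 ^ j" "k * 2 ^ j + 2 ^ j" "\<lambda>i. f (grid a b (n + j) i)"]
    grid_refine[of a b n j k] grid_refine[of a b n j "Suc k"]
  by (simp add: add.commute)

text \<open>Each coarse cell is a block of \<open>2 ^ (m - n)\<close> fine cells, and the triangle
  inequality bounds its increment by the sum over the block.\<close>

lemma grid_variation_mono: "n \<le> m \<Longrightarrow> grid_variation f a b n \<le> grid_variation f a b m"
  using grid_variation_block_ge[of f a b n _ "m - n"] grid_variation_blocks[of f a b n "m - n"]
  by (auto simp: grid_variation_def intro!: sum_mono)

text \<open>A bounded nondecreasing sequence of integers is eventually constant; this is why the
  grid variation takes values in \<open>int\<close>.\<close>

lemma grid_variation_stabilizes: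
  assumes "\<And>n. grid_variation f a b n \<le> K"
  obtains n0 where "\<And>n. n \<ge> n0 \<Longrightarrow> grid_variation f a b n = grid_variation f a b n0"
proof -
  have "finite (range (grid_variation f a b))"
    by (rule finite_subset[of _ "{0..K}"]) (use assms in \<open>auto simp: grid_variation_def intro: sum_nonneg\<close>)
  then have "Max (range (grid_variation f a b)) \<in> range (grid_variation f a b)"
    by (intro Max_in) auto
  then obtain n0 where n0: "Max (range (grid_variation f a b)) = grid_variation f a b n0"
    by auto
  have "grid_variation f a b n \<le> grid_variation f a b n0" for n
    unfolding n0[symmetric] using \<open>finite _\<close> by (intro Max_ge) auto
  then show ?thesis
    using that[of n0] grid_variation_mono[of n0 _ f a b] by (simp add: antisym)
qed

text \<open>The block sums dominate the coarse increments term by term, so equality of the totals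
  forces equality in every block.\<close>

lemma grid_variation_constant_imp_block:
  assumes const: "grid_variation f a b (n + j) = grid_variation f a b n" and k: "k < 2 ^ n"
  shows "(\<Sum>i = k * 2 ^ j..<k * 2 ^ j + 2 ^ j. \<bar>f (grid a b (n + j) (Suc i)) - f (grid a b (n + j) i)\<bar>)
    = \<bar>f (grid a b n (Suc k)) - f (grid a b n k)\<bar>"
proof (rule ccontr)
  assume "\<not> ?thesis"
  then have "grid_variation f a b n < grid_variation f a b (n + j)"
    using grid_variation_block_ge[of f a b n k j] k
    unfolding grid_variation_blocks unfolding grid_variation_def
    by (intro sum_strict_mono_ex1 ballI grid_variation_block_ge) (auto intro!: bexI[of _ k])
  with const show False by simp
qed

text \<open>Once the number of sign changes along the grids has stabilized, every cell with a sign change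
  contains only one of them at all finer levels.\<close>

lemma antimono_on_cell:
  assumes const: "\<And>m. m \<ge> n \<Longrightarrow> grid_variation f a b m = grid_variation f a b n"
    and ab: "a < b" and k: "k < 2 ^ n"
    and f: "f (grid a b n k) = 1" "f (grid a b n (Suc k)) = 0"
    and d: "d \<in> dyadic_points a b" "d' \<in> dyadic_points a b" "grid a b n k \<le> d" "d \<le> d'" "d'
        \<le> grid a b n (Suc k)"
  shows "f d' \<le> f d"
proof -
  obtain m i i' where m: "m \<ge> n" "d = grid a b m i" "d' = grid a b m i'"
    using dyadic_points_common_level[OF d(1,2), of n] by blast
  define j where "j = m - n"
  have mj: "m = n + j" using m by (simp add: j_def)
  let ?g = "\<lambda>i. f (grid a b m i)"
  let ?lo = "k * 2 ^ j" and ?hi = "k * 2 ^ j + 2 ^ j"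
  have lo: "grid a b n k = grid a b m ?lo" and hi: "grid a b n (Suc k) = grid a b m ?hi"
    using grid_refine[of a b n j k] grid_refine[of a b n j "Suc k"] by (simp_all add: mj add.commute)
  have ord: "?lo \<le> i" "i \<le> i'" "i' \<le> ?hi"
    using d(3-5) unfolding lo hi m(2,3) by (simp_all add: grid_le_iff[OF ab])
  \<comment> \<open>The variation of \<open>f\<close> over the cell equals its net change, from 1 to
    0. A rise from \<open>d\<close> to \<open>d'\<close> would have to be made up by further descent
    and would push the variation above 1.\<close>
  have "\<bar>?g i - ?g ?lo\<bar> + \<bar>?g i' - ?g i\<bar> + \<bar>?g ?hi - ?g i'\<bar> \<le>
      (\<Sum>k=?lo..<i. \<bar>?g (Suc k) - ?g k\<bar>) + (\<Sum>k=i..<i'. \<bar>?g (Suc k) - ?g k\<bar>)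
          + (\<Sum>k=i'..<?hi. \<bar>?g (Suc k) - ?g k\<bar>)"
    by (intro add_mono abs_diff_le_sum ord)
  also have "\<dots> = (\<Sum>k=?lo..<?hi. \<bar>?g (Suc k) - ?g k\<bar>)"
    using ord by (simp add: sum.atLeastLessThan_concat)
  also have "\<dots> = \<bar>f (grid a b n (Suc k)) - f (grid a b n k)\<bar>"
    unfolding mj by (rule grid_variation_constant_imp_block[OF const k]) simp
  finally show ?thesis
    using f by (simp add: m lo[symmetric] hi[symmetric])
qed

subsection \<open>Level crossings of cadlag paths\<close>

definition upcrossings :: "(real \<Rightarrow> real) \<Rightarrow> real \<Rightarrow> real \<Rightarrow> nat \<Rightarrow> real \<Rightarrow> nat set" where
  "upcrossings V a b n x = {k. k < 2 ^ n \<and> V (grid a b n k) < x \<and> x < V (grid a b n (Suc k))}"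

definition downcrossings :: "(real \<Rightarrow> real) \<Rightarrow> real \<Rightarrow> real \<Rightarrow> nat \<Rightarrow> real \<Rightarrow> nat set" where
  "downcrossings V a b n x = {k. k < 2 ^ n \<and> x < V (grid a b n k) \<and> V (grid a b n (Suc k)) < x}"

lemma downcrossings_eq: "downcrossings V a b n x = upcrossings (\<lambda>s. - V s) a b n (- x)"
  by (auto simp: upcrossings_def downcrossings_def)

lemma finite_upcrossings [simp]: "finite (upcrossings V a b n x)"
  by (rule finite_subset[of _ "{..<2 ^ n}"]) (auto simp: upcrossings_def)

lemma finite_downcrossings [simp]: "finite (downcrossings V a b n x)"
  by (simp add: downcrossings_eq)

text \<open>As no grid value equals \<open>x\<close>, the indicator of \<open>V u < x\<close>
  changes over a cell exactly when the cell is an upcrossing or a downcrossing, and then by one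
  unit.\<close>

lemma card_crossings:
  assumes "a < b" "x \<notin> V ` dyadic_points a b"
  shows "int (card (upcrossings V a b n x)) + int (card (downcrossings V a b n x)) =
    grid_variation (\<lambda>u. of_bool (V u < x)) a b n"
proof -
  have neq: "V (grid a b n k) \<noteq> x" if "k \<le> 2 ^ n" for k
    using assms grid_in_dyadic_points[OF that, of a b] by auto
  have "grid_variation (\<lambda>u. of_bool (V u < x)) a b n =
      (\<Sum>k<2 ^ n. if k \<in> upcrossings V a b n x \<union> downcrossings V a b n x then 1 else 0)"
    unfolding grid_variation_def
  proof (rule sum.cong)
    fix k :: nat assume "k \<in> {..<2 ^ n}"
    then have "V (grid a b n k) \<noteq> x" "V (grid a b n (Suc k)) \<noteq> x"
      by (auto intro!: neq)
    then show "\<bar>of_bool (V (grid a b n (Suc k)) < x) - of_bool (V (grid a b n k) < x)\<bar> =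
       (if k \<in> upcrossings V a b n x \<union> downcrossings V a b n x then 1 else 0 :: int)"
      using \<open>k \<in> {..<2 ^ n}\<close> by (auto simp: upcrossings_def downcrossings_def)
  qed simp
  also have "\<dots> = int (card ({..<2 ^ n} \<inter> (upcrossings V a b n x \<union> downcrossings V a b n x)))"
    by (simp add: sum.If_cases Int_def)
  also have "{..<2 ^ n} \<inter> (upcrossings V a b n x \<union> downcrossings V a b n x) =
      upcrossings V a b n x \<union> downcrossings V a b n x"
    by (auto simp: upcrossings_def downcrossings_def)
  also have "card \<dots> = card (upcrossings V a b n x) + card (downcrossings V a b n x)"
    by (rule card_Un_disjoint) (auto simp: upcrossings_def downcrossings_def)
  finally show ?thesis by simp
qed

text \<open>Passages from below \<open>x\<close> to above \<open>x\<close>, continuous or by a jump.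
  At \<open>s\<close> itself only \<open>x \<le> V s\<close> is asked, which allows both
  \<open>V s = x\<close> and a jump beyond \<open>x\<close>.\<close>

definition up_times :: "(real \<Rightarrow> real) \<Rightarrow> real \<Rightarrow> real set" where
  "up_times V x = {s. 0 < s \<and> x \<le> V s \<and> (\<exists>\<delta>>0. (\<forall>u. 0 \<le> u \<and> s
      - \<delta> < u \<and> u < s \<longrightarrow> V u < x) \<and>
     (\<forall>u. s < u \<and> u < s + \<delta> \<longrightarrow> x < V u))}"

section \<open>Exceptional levels\<close>

definition local_min_values :: "(real \<Rightarrow> real) \<Rightarrow> real set" where
  "local_min_values f = {f r | r. \<exists>\<delta>>0. \<forall>u. \<bar>u - r\<bar> < \<delta> \<longrightarrow> f r
      \<le> f u}"

lemma local_min_valuesI: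
  "0 < \<delta> \<Longrightarrow> (\<And>u. \<bar>u - r\<bar> < \<delta> \<Longrightarrow> f r \<le> f u)
      \<Longrightarrow> f r \<in> local_min_values f"
  by (auto simp: local_min_values_def)

text \<open>A local minimum value is the infimum of \<open>f\<close> over a small interval with
  rational endpoints, and there are countably many such intervals. Applied to
  \<open>\<lambda>u. - V u\<close> this covers local maxima.\<close>

lemma countable_local_min_values: "countable (local_min_values f)"
proof (rule countable_subset)
  let ?g = "\<lambda>(p, q). Inf (f ` {real_of_rat p<..<real_of_rat q})"
  show "local_min_values f \<subseteq> range ?g"
  proof
    fix y assume "y \<in> local_min_values f"
    then obtain r \<delta> where r: "y = f r" "\<delta> > 0" "\<And>u. \<bar>u - r\<bar> < \<delta>
        \<Longrightarrow> f r \<le> f u"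
      by (auto simp: local_min_values_def)
    obtain p q where pq: "r - \<delta> < real_of_rat p" "real_of_rat p < r"
        "r < real_of_rat q" "real_of_rat q < r + \<delta>"
      using of_rat_dense[of "r - \<delta>" r] of_rat_dense[of r "r + \<delta>"] r(2) by auto
    have "Inf (f ` {real_of_rat p<..<real_of_rat q}) = f r"
      by (rule cInf_eq_minimum) (use pq r(3) in auto)
    then show "y \<in> range ?g"
      using r(1) by (auto intro!: image_eqI[of _ _ "(p, q)"])
  qed
qed simp

section \<open>Correspondence of upcrossings and up times\<close>

locale cadlag_path =
  fixes V :: "real \<Rightarrow> real"
  assumes cadlag: "cadlag V"
begin

lemma right_cont: "0 \<le> s \<Longrightarrow> (V \<longlongrightarrow> V s) (at_right s)"
  using cadlag by (auto simp: cadlag_def continuous_within)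

lemma left_lim: "0 < s \<Longrightarrow> (V \<longlongrightarrow> left_lim V s) (at_left s)"
  using cadlag by (auto simp: cadlag_def left_lim_def tendsto_Lim)

lemma above_on_right:
  assumes "0 \<le> s" "x < V s"
  obtains w where "s < w" "\<And>u. s < u \<Longrightarrow> u < w \<Longrightarrow> x < V u"
  using order_tendstoD(1)[OF right_cont[OF assms(1)] assms(2)]
  by (auto simp: eventually_at_right_field)

lemma below_on_right:
  assumes "0 \<le> s" "V s < x"
  obtains w where "s < w" "\<And>u. s < u \<Longrightarrow> u < w \<Longrightarrow> V u < x"
  using order_tendstoD(2)[OF right_cont[OF assms(1)] assms(2)]
  by (auto simp: eventually_at_right_field)

text \<open>Right continuity: a value above \<open>x\<close> at \<open>s\<close> would persist on
  some interval to the right, which contains dyadic points.\<close>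

lemma le_of_dyadic_points:
  assumes "0 \<le> a" "a \<le> s" "s < w" "w \<le> b" "\<And>d. d \<in> dyadic_points a b \<Longrightarrow> s < d
      \<Longrightarrow> d < w \<Longrightarrow> V d \<le> x"
  shows "V s \<le> x"
proof (rule ccontr)
  assume "\<not> ?thesis"
  then obtain z where z: "s < z" "\<And>u. s < u \<Longrightarrow> u < z \<Longrightarrow> x < V u"
    using above_on_right[of s x] assms by auto
  obtain d where "d \<in> dyadic_points a b" "s < d" "d < min w z"
    by (rule dyadic_points_dense[of a s "min w z" b]) (use assms z that in auto)
  then show False
    using assms(5)[of d] z(2)[of d] by auto
qed

lemma ge_of_dyadic_points:
  assumes "0 \<le> a" "a \<le> s" "s < w" "w \<le> b" "\<And>d. d \<in> dyadic_points a b \<Longrightarrow> s < d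
      \<Longrightarrow> d < w \<Longrightarrow> x \<le> V d"
  shows "x \<le> V s"
proof (rule ccontr)
  assume "\<not> ?thesis"
  then obtain z where z: "s < z" "\<And>u. s < u \<Longrightarrow> u < z \<Longrightarrow> V u < x"
    using below_on_right[of s x] assms by auto
  obtain d where "d \<in> dyadic_points a b" "s < d" "d < min w z"
    by (rule dyadic_points_dense[of a s "min w z" b]) (use assms z that in auto)
  then show False
    using assms(5)[of d] z(2)[of d] by auto
qed

text \<open>After stabilization, the dyadic times in the cell with value below \<open>x\<close> all
  precede those with value above; the separating time \<open>s\<close> is the supremum of the
  former. Right continuity carries the weak inequalities to all times, and avoiding local extremal
  values makes them strict.\<close>

lemma up_time_in_cell:
  assumes ab: "0 \<le> a" "a < b"
    and const: "\<And>m. m \<ge> n \<Longrightarrow> grid_variation (\<lambda>u. of_bool (V u < x)) a b m =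
      grid_variation (\<lambda>u. of_bool (V u < x)) a b n"
    and x: "x \<notin> V ` dyadic_points a b" "x \<notin> local_min_values V" "- x \<notin> local_min_values (\<lambda>u. - V u)"
    and k: "k \<in> upcrossings V a b n x"
  obtains s where "s \<in> up_times V x" "grid a b n k < s" "s \<le> grid a b n (Suc k)"
proof -
  define u w where "u = grid a b n k" and "w = grid a b n (Suc k)"
  have kn: "k < 2 ^ n" and Vu: "V u < x" and Vw: "x < V w"
    using k by (auto simp: upcrossings_def u_def w_def)
  have uD: "u \<in> dyadic_points a b"
    using kn by (auto simp: u_def intro!: grid_in_dyadic_points)
  have uw: "a \<le> u" "u < w" "w \<le> b" "0 \<le> u"
    using ab kn grid_ge[of a b n k] by (auto simp: u_def w_def grid_less_iff intro!: grid_le)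
  have mono: "V d < x" if "V d' < x" "d \<in> dyadic_points a b" "d' \<in> dyadic_points a b" "u \<le> d" "d
      \<le> d'" "d' \<le> w" for d d'
  proof -
    have "of_bool (V d' < x) \<le> (of_bool (V d < x) :: int)"
      by (rule antimono_on_cell[OF const ab(2) kn]) (use that Vu Vw in \<open>auto simp: u_def w_def\<close>)
    then show ?thesis
      using that(1) by (cases "V d < x") simp_all
  qed
  define S where "S = {d \<in> dyadic_points a b. u \<le> d \<and> d \<le> w \<and> V d < x}"
  define s where "s = Sup S"
  have uS: "u \<in> S" and bdd: "bdd_above S"
    using uD Vu uw by (auto simp: S_def intro!: bdd_aboveI[of _ w])
  have su: "u \<le> s"
    unfolding s_def by (rule cSup_upper[OF uS bdd])
  have sw: "s \<le> w"
    unfolding s_def using uS by (intro cSup_least) (auto simp: S_def)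
  have below: "V d < x" if d: "d \<in> dyadic_points a b" "u \<le> d" "d < s" for d
  proof -
    obtain d' where d': "d' \<in> S" "d < d'"
      using d(3) less_cSup_iff[of S d] uS bdd by (auto simp: s_def)
    then show ?thesis
      using mono[of d' d] d by (auto simp: S_def)
  qed
  have above: "x < V d" if d: "d \<in> dyadic_points a b" "s < d" "d \<le> w" for d
  proof -
    have "d \<notin> S"
    proof
      assume "d \<in> S"
      then have "d \<le> s"
        unfolding s_def by (rule cSup_upper[OF _ bdd])
      with d show False by simp
    qed
    then have "x \<le> V d"
      using d su by (auto simp: S_def)
    then show ?thesis
      using x(1) d(1) by (cases "V d = x") auto
  qed
  \<comment> \<open>Otherwise every dyadic time of the cell to the right of \<open>u\<close> has
    value above \<open>x\<close>, and right continuity gives \<open>x \<le> V u\<close>.\<close>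
  have us: "u < s"
  proof (rule ccontr)
    assume "\<not> ?thesis"
    then have "s = u" using su by simp
    then have "x \<le> V u"
      using above uw ab by (intro ge_of_dyadic_points[of a u w b]) (auto intro: less_imp_le)
    with Vu show False by simp
  qed
  have le: "V r \<le> x" if "u \<le> r" "r < s" for r
    using that uw ab sw below by (intro le_of_dyadic_points[of a r s b]) (auto intro: less_imp_le)
  have ge: "x \<le> V r" if "s \<le> r" "r < w" for r
    using that uw ab us above by (intro ge_of_dyadic_points[of a r w b]) (auto intro: less_imp_le)
  \<comment> \<open>A time in the open interval with value \<open>x\<close> would be a local
    maximum, since nearby values are at most \<open>x\<close>.\<close>
  have lt: "V r < x" if r: "u < r" "r < s" for r
  proof (rule ccontr)
    assume "\<not> ?thesis"
    have "V r = x" using \<open>\<not> V r < x\<close> le[of r] r by simp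
    moreover have "- V r \<in> local_min_values (\<lambda>u. - V u)"
      by (rule local_min_valuesI[of "min (r - u) (s - r)"]) (use r le \<open>V r = x\<close> in auto)
    ultimately show False using x by simp
  qed
  have gt: "x < V r" if r: "s < r" "r < w" for r
  proof (rule ccontr)
    assume "\<not> ?thesis"
    have "V r = x" using \<open>\<not> x < V r\<close> ge[of r] r by simp
    moreover have "V r \<in> local_min_values V"
      by (rule local_min_valuesI[of "min (r - s) (w - r)"]) (use r ge \<open>V r = x\<close> in auto)
    ultimately show False using x by simp
  qed
  \<comment> \<open>When \<open>s\<close> is the right end of the cell, what follows lies outside
    the cell and is controlled by right continuity at \<open>w\<close>.\<close>
  obtain \<epsilon> where \<epsilon>: "\<epsilon> > 0" "\<And>r. s < r \<Longrightarrow> r < s + \<epsilon>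
      \<Longrightarrow> x < V r"
  proof (cases "s < w")
    case True
    then show ?thesis using that[of "w - s"] gt by auto
  next
    case False
    then have "s = w" using sw by simp
    moreover obtain z where "w < z" "\<And>r. w < r \<Longrightarrow> r < z \<Longrightarrow> x < V r"
      using above_on_right[OF _ Vw] uw by auto
    ultimately show ?thesis using that[of "z - w"] by auto
  qed
  have "x \<le> V s"
    using ge[of s] Vw sw by (cases "s = w") auto
  then have "s \<in> up_times V x"
    using us uw \<epsilon> lt unfolding up_times_def
    by (auto intro!: exI[of _ "min \<epsilon> (s - u)"])
  then show ?thesis
    using that[of s] us sw by (auto simp: u_def w_def)
qed

text \<open>Once the mesh is below the radius \<open>\<delta>\<close> witnessing the up time, the
  cell around \<open>s\<close> lies in the window where the sign of \<open>V - x\<close> is known.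
  The bound on \<open>V u\<close> before \<open>s\<close> serves to separate different up
  times.\<close>

lemma up_time_crossing:
  assumes ab: "0 \<le> a" "a < b" and s: "s \<in> up_times V x" "a < s" "s \<le> b"
    and x: "x \<notin> V ` dyadic_points a b"
  shows "\<forall>\<^sub>F n in sequentially. \<forall>k<2 ^ n. grid a b n k < s \<and> s
      \<le> grid a b n (Suc k) \<longrightarrow>
    k \<in> upcrossings V a b n x \<and> (\<forall>u. grid a b n k < u \<and> u < s \<longrightarrow> V u < x)"
proof -
  obtain \<delta> where \<delta>: "\<delta> > 0" "\<And>u. 0 \<le> u \<Longrightarrow> s - \<delta> < u
      \<Longrightarrow> u < s \<Longrightarrow> V u < x"
    "\<And>u. s < u \<Longrightarrow> u < s + \<delta> \<Longrightarrow> x < V u" and Vs: "x \<le> V s"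
    using s by (auto simp: up_times_def)
  have "\<forall>\<^sub>F n in sequentially. (b - a) / 2 ^ n < \<delta>"
    using \<delta> by (intro order_tendstoD(2)[OF mesh_tendsto_0]) auto
  then show ?thesis
  proof eventually_elim
    fix n assume n: "(b - a) / 2 ^ n < \<delta>"
    show "\<forall>k<2 ^ n. grid a b n k < s \<and> s \<le> grid a b n (Suc k) \<longrightarrow>
      k \<in> upcrossings V a b n x \<and> (\<forall>u. grid a b n k < u \<and> u < s \<longrightarrow> V u < x)"
    proof (intro allI impI conjI; (elim conjE)?)
      fix k :: nat assume k: "k < 2 ^ n" "grid a b n k < s" "s \<le> grid a b n (Suc k)"
      have g: "a \<le> grid a b n k" "s - \<delta> < grid a b n k" "grid a b n (Suc k) < s + \<delta>"
        using k n ab grid_ge[of a b n k] by (auto simp: grid_Suc)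
      have "x \<noteq> V (grid a b n (Suc k))"
        using x grid_in_dyadic_points[of "Suc k" n a b] k by auto
      moreover have "x \<le> V (grid a b n (Suc k))"
        using \<delta>(3)[of "grid a b n (Suc k)"] g k Vs by (cases "s = grid a b n (Suc k)") auto
      moreover have "V (grid a b n k) < x"
        using \<delta>(2) g k ab by auto
      ultimately show "k \<in> upcrossings V a b n x"
        using k by (auto simp: upcrossings_def)
      show "V u < x" if "grid a b n k < u" "u < s" for u
        using that g ab by (intro \<delta>(2)) auto
    qed
  qed
qed

text \<open>Two up times cannot share a cell of a fine grid: before the later one the path is below
  \<open>x\<close> inside the cell, whereas at the earlier one it is at least \<open>x\<close>.
  Hence up times inject into upcrossings.\<close>

lemma card_le_upcrossings:
  assumes ab: "0 \<le> a" "a < b" and F: "F \<subseteq> up_times V x \<inter> {a<..b}" "finite F"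
    and x: "x \<notin> V ` dyadic_points a b"
  shows "\<forall>\<^sub>F n in sequentially. card F \<le> card (upcrossings V a b n x)"
proof -
  have "\<forall>\<^sub>F n in sequentially. \<forall>s\<in>F. \<forall>k<2 ^ n. grid a b n k < s \<and> s
      \<le> grid a b n (Suc k) \<longrightarrow>
    k \<in> upcrossings V a b n x \<and> (\<forall>u. grid a b n k < u \<and> u < s \<longrightarrow> V u < x)"
    using F by (intro eventually_ball_finite ballI up_time_crossing ab x) auto
  then show ?thesis
  proof eventually_elim
    fix n assume *: "\<forall>s\<in>F. \<forall>k<2 ^ n. grid a b n k < s \<and> s \<le> grid a b n (Suc k) \<longrightarrow>
      k \<in> upcrossings V a b n x \<and> (\<forall>u. grid a b n k < u \<and> u < s \<longrightarrow> V u < x)"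
    have "\<exists>k<2 ^ n. grid a b n k < s \<and> s \<le> grid a b n (Suc k)" if "s \<in> F" for s
      by (rule grid_cell[OF ab(2), of s n]) (use that F in auto)
    then obtain c where c: "\<And>s. s \<in> F \<Longrightarrow> c s < 2 ^ n \<and> grid a b n (c s) < s \<and> s
        \<le> grid a b n (Suc (c s))"
      by metis
    have ge: "x \<le> V s" if "s \<in> F" for s
      using that F by (auto simp: up_times_def)
    have "inj_on c F"
    proof (rule inj_onI)
      fix s s' assume s: "s \<in> F" "s' \<in> F" "c s = c s'"
      have "V u < x" if "u < r" "u \<in> F" "r \<in> F" "c u = c r" for u r
        using *[rule_format, OF that(3), of "c r"] that c[OF that(2)] c[OF that(3)] by auto
      from this[of s s'] this[of s' s] show "s = s'"
        using ge[of s] ge[of s'] s by (cases s s' rule: linorder_cases) auto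
    qed
    moreover have "c ` F \<subseteq> upcrossings V a b n x"
      using * c by blast
    ultimately show "card F \<le> card (upcrossings V a b n x)"
      by (metis card_inj_on_le finite_upcrossings)
  qed
qed

text \<open>The bound \<open>K\<close> limits the size of every finite set of up times, which gives
  finiteness. Up times inject into upcrossings on fine grids; after stabilization each upcrossing
  cell contains an up time, which gives the reverse injection as cells are disjoint.\<close>

lemma upcrossings_eventually_eq:
  assumes ab: "0 \<le> a" "a < b"
    and x: "x \<notin> V ` dyadic_points a b" "x \<notin> local_min_values V" "- x \<notin> local_min_values (\<lambda>u. - V u)"
    and bdd: "\<And>n. grid_variation (\<lambda>u. of_bool (V u < x)) a b n \<le> K"
  shows "finite (up_times V x \<inter> {a<..b})"
    and "\<forall>\<^sub>F n in sequentially. card (upcrossings V a b n x) = card (up_times V x \<inter> {a<..b})"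
proof -
  let ?U = "up_times V x \<inter> {a<..b}"
  have le: "card (upcrossings V a b n x) \<le> nat K" for n
    using card_crossings[OF ab(2) x(1), of n] bdd[of n] by linarith
  show fin: "finite ?U"
  proof (rule ccontr)
    assume "infinite ?U"
    then obtain F where F: "F \<subseteq> ?U" "finite F" "card F = Suc (nat K)"
      by (meson infinite_arbitrarily_large)
    from card_le_upcrossings[OF ab F(1,2) x(1)] obtain n where "card F \<le> card (upcrossings V a b n x)"
      by (auto simp: eventually_sequentially)
    with F le[of n] show False by simp
  qed
  obtain n0 where n0: "\<And>n. n \<ge> n0 \<Longrightarrow> grid_variation (\<lambda>u. of_bool (V u < x)) a b n =
      grid_variation (\<lambda>u. of_bool (V u < x)) a b n0"
    using grid_variation_stabilizes[OF bdd] by blast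
  have "card (upcrossings V a b n x) \<le> card ?U" if n: "n \<ge> n0" for n
  proof -
    have const: "grid_variation (\<lambda>u. of_bool (V u < x)) a b m =
      grid_variation (\<lambda>u. of_bool (V u < x)) a b n" if "m \<ge> n" for m
      using n0[of m] n0[of n] n that by simp
    have "\<exists>s\<in>up_times V x. grid a b n k < s \<and> s \<le> grid a b n (Suc k)"
        if "k \<in> upcrossings V a b n x" for k
      by (rule up_time_in_cell[OF ab const x that]) auto
    then obtain \<sigma> where \<sigma>: "\<And>k. k \<in> upcrossings V a b n x \<Longrightarrow>
        \<sigma> k \<in> up_times V x \<and> grid a b n k < \<sigma> k \<and> \<sigma> k \<le> grid a b n (Suc k)"
      by metis
    have "\<sigma> ` upcrossings V a b n x \<subseteq> ?U"
    proof safe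
      fix k assume k: "k \<in> upcrossings V a b n x"
      then have "a \<le> grid a b n k" "grid a b n (Suc k) \<le> b"
        using ab by (auto simp: upcrossings_def intro!: grid_ge grid_le)
      then show "\<sigma> k \<in> {a<..b}" "\<sigma> k \<in> up_times V x"
        using \<sigma>[OF k] by auto
    qed
    moreover have "inj_on \<sigma> (upcrossings V a b n x)"
    proof (rule inj_onI)
      fix k k' assume k: "k \<in> upcrossings V a b n x" "k' \<in> upcrossings V a b n x" "\<sigma> k = \<sigma> k'"
      then have "grid a b n k < grid a b n (Suc k')" "grid a b n k' < grid a b n (Suc k)"
        using \<sigma>[of k] \<sigma>[of k'] by auto
      then show "k = k'"
        by (simp add: grid_less_iff[OF ab(2)])
    qed
    ultimately show ?thesis
      using fin by (metis card_inj_on_le)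
  qed
  then have "\<forall>\<^sub>F n in sequentially. card (upcrossings V a b n x) \<le> card ?U"
    by (auto simp: eventually_sequentially)
  then show "\<forall>\<^sub>F n in sequentially. card (upcrossings V a b n x) = card ?U"
    using card_le_upcrossings[OF ab order_refl fin x(1)] by eventually_elim simp
qed

end

subsection \<open>Integrated point counts\<close>

text \<open>Preimages of an open set under \<open>f\<close> and \<open>g\<close> differ by a null
  set, which is harmless in a completion. This yields measurability in the level of counts that are
  identified only almost everywhere.\<close>

lemma borel_measurable_completion_AE:
  fixes f g :: "'a \<Rightarrow> 'b :: topological_space"
  assumes f: "f \<in> borel_measurable (completion M)" and ae: "AE x in completion M. f x = g x"
  shows "g \<in> borel_measurable (completion M)"
proof (rule borel_measurableI)
  fix A :: "'b set" assume "open A"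
  then have "f -` A \<inter> space M \<in> sets (completion M)"
    using measurable_sets[OF f, of A] by simp
  moreover have "AE x in completion M. x \<in> f -` A \<inter> space M \<longleftrightarrow> x \<in> g -` A \<inter> space M"
    using ae by eventually_elim simp
  ultimately have "g -` A \<inter> space M \<in> sets (completion M)"
    by (intro completion.in_sets_AE[where B="g -` A \<inter> space M"]) auto
  then show "g -` A \<inter> space (completion M) \<in> sets (completion M)"
    by simp
qed

text \<open>Infinite sets get the value \<open>top\<close>, whereas \<open>card\<close> gives them
  0; so additivity and monotonicity hold without finiteness assumptions.\<close>

abbreviation ecard :: "'a set \<Rightarrow> ennreal" where
  "ecard \<equiv> emeasure (count_space UNIV)"

lemma ecard_Un: "A \<inter> B = {} \<Longrightarrow> ecard (A \<union> B) = ecard A + ecard B"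
  by (rule plus_emeasure[symmetric]) auto

lemma ecard_Ioc_split:
  fixes S :: "real set"
  shows "a \<le> b \<Longrightarrow> b \<le> c \<Longrightarrow> ecard (S \<inter> {a<..c})
      = ecard (S \<inter> {a<..b}) + ecard (S \<inter> {b<..c})"
  by (subst ecard_Un[symmetric]) (auto intro!: arg_cong[where f=ecard])

lemma ecard_mono: "A \<subseteq> B \<Longrightarrow> ecard A \<le> ecard B"
  by (rule emeasure_mono) auto

lemma ecard_eq_top_iff: "ecard A = top \<longleftrightarrow> infinite A"
  by (simp add: emeasure_count_space ennreal_of_nat_eq_real_of_nat)

lemma card_eq_enn2real: "real (card A) = enn2real (ecard A)"
  by (simp add: emeasure_count_space ennreal_of_nat_eq_real_of_nat)

text \<open>\<open>S x\<close> is the set of times counted at level \<open>x\<close>, and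
  \<open>F\<close> is the distribution function of the counts integrated over all levels. The
  formula is assumed for intervals and extended to Borel sets of times below.\<close>

locale counting_kernel =
  fixes S :: "real \<Rightarrow> real set" and F :: "real \<Rightarrow> real"
  assumes mono: "a \<le> b \<Longrightarrow> F a \<le> F b"
    and meas: "a \<le> b \<Longrightarrow> (\<lambda>x. ecard (S x \<inter> {a<..b})) \<in> borel_measurable lebesgue"
    and int: "a \<le> b \<Longrightarrow> (\<integral>\<^sup>+x. ecard (S x \<inter> {a<..b}) \<partial>lebesgue)
        = ennreal (F b - F a)"
begin

lemma AE_finite: 
  assumes "a \<le> b"
  shows "AE x in lebesgue. finite (S x \<inter> {a<..b})"
proof -
  have "AE x in lebesgue. ecard (S x \<inter> {a<..b}) \<noteq> \<infinity>"
    using assms by (intro nn_integral_PInf_AE meas) (simp_all add: int)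
  then show ?thesis
    by eventually_elim (simp add: ecard_eq_top_iff infinity_ennreal_def del: emeasure_count_space_eq_0)
qed

text \<open>Dominated convergence: for almost every \<open>x\<close> the set
  \<open>S x \<inter> {a<..a + 1}\<close> is finite, so \<open>S x \<inter> {a<..X n}\<close> is
  empty for large \<open>n\<close>.\<close>

lemma right_cont: "continuous (at_right a) F"
proof -
  have "(F \<longlongrightarrow> F a) (at_right a)"
  proof (rule tendsto_at_right_sequentially[of a "a + 1"])
    fix X :: "nat \<Rightarrow> real" assume X: "\<And>n. a < X n" "\<And>n. X n < a + 1" "decseq X" "X
        \<longlonglongrightarrow> a"
    have "(\<lambda>n. \<integral>\<^sup>+x. ecard (S x \<inter> {a<..X n}) \<partial>lebesgue)
        \<longlonglongrightarrow> (\<integral>\<^sup>+x. 0 \<partial>(lebesgue :: real measure))"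
    proof (rule nn_integral_dominated_convergence[where u="\<lambda>n x. ecard (S x \<inter> {a<..X n})"
        and u'="\<lambda>_. 0" and w="\<lambda>x. ecard (S x \<inter> {a<..a + 1})"])
      show "(\<integral>\<^sup>+x. ecard (S x \<inter> {a<..a + 1}) \<partial>lebesgue) < \<infinity>"
        by (simp add: int)
      show "AE x in lebesgue. ecard (S x \<inter> {a<..X n}) \<le> ecard (S x \<inter> {a<..a + 1})" for n
        using X(2)[of n] by (intro AE_I2 ecard_mono) auto
      have "AE x in lebesgue. finite (S x \<inter> {a<..a + 1})"
        by (rule AE_finite) simp
      then show "AE x in lebesgue. (\<lambda>n. ecard (S x \<inter> {a<..X n})) \<longlonglongrightarrow> 0"
      proof eventually_elim
        fix x assume fin: "finite (S x \<inter> {a<..a + 1})"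
        have "\<forall>\<^sub>F n in sequentially. \<forall>s\<in>S x \<inter> {a<..a + 1}. X n < s"
          using fin by (intro eventually_ball_finite ballI order_tendstoD[OF X(4)]) auto
        then have "\<forall>\<^sub>F n in sequentially. ecard (S x \<inter> {a<..X n}) = 0"
        proof eventually_elim
          fix n assume *: "\<forall>s\<in>S x \<inter> {a<..a + 1}. X n < s"
          have "S x \<inter> {a<..X n} = {}"
          proof safe
            fix s assume "s \<in> S x" "s \<in> {a<..X n}"
            moreover from this have "X n < s"
              using * X(2)[of n] by simp
            ultimately show "s \<in> {}" by simp
          qed
          then show "ecard (S x \<inter> {a<..X n}) = 0" by simp
        qed
        then show "(\<lambda>n. ecard (S x \<inter> {a<..X n})) \<longlonglongrightarrow> 0"
          by (rule tendsto_eventually)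
      qed
    qed (use X(1) in \<open>auto intro!: meas less_imp_le\<close>)
    then have "(\<lambda>n. ennreal (F (X n) - F a)) \<longlonglongrightarrow> ennreal 0"
      using X(1) by (simp add: int less_imp_le)
    then have "(\<lambda>n. F (X n) - F a) \<longlonglongrightarrow> 0"
      using mono[OF less_imp_le[OF X(1)]] by (subst (asm) tendsto_ennreal_iff) auto
    then show "(\<lambda>n. F (X n)) \<longlonglongrightarrow> F a"
      by (simp add: LIM_zero_iff)
  qed simp
  then show ?thesis
    by (simp add: continuous_within)
qed

lemma Ioc: "a \<le> b \<Longrightarrow> emeasure (interval_measure F) {a<..b} = ennreal (F b - F a)"
  by (rule emeasure_interval_measure_Ioc) (auto intro: mono right_cont)

text \<open>Induction from half-open intervals, a generator closed under intersection, to all Borel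
  sets. Cutting with \<open>{a<..b}\<close> keeps the masses finite, as complements require, and
  measurability in \<open>x\<close> is carried along.\<close>

lemma Borel:
  assumes B: "B \<in> sets borel" and ab: "a \<le> b"
  shows "(\<lambda>x. ecard (S x \<inter> (B \<inter> {a<..b}))) \<in> borel_measurable lebesgue \<and>
    (\<integral>\<^sup>+x. ecard (S x \<inter> (B \<inter> {a<..b})) \<partial>lebesgue)
        = emeasure (interval_measure F) (B \<inter> {a<..b})"
proof -
  let ?G = "range (\<lambda>(c, d). {c<..d :: real})"
  have "Int_stable ?G"
    by (auto simp: Int_stable_def)
  moreover have "?G \<subseteq> Pow UNIV" by simp
  moreover have "B \<in> sigma_sets UNIV ?G"
    using B by (simp add: borel_sigma_sets_Ioc)
  ultimately show ?thesis
  proof (induct rule: sigma_sets_induct_disjoint)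
    case (basic A)
    then obtain c d where A: "A = {c<..d}" by auto
    show ?case
    proof (cases "max c a \<le> min d b")
      case True
      have "A \<inter> {a<..b} = {max c a<..min d b}"
        using A by auto
      then show ?thesis
        using meas[OF True] int[OF True] Ioc[OF True] by simp
    next
      case False
      then have "A \<inter> {a<..b} = {}" using A ab by auto
      then show ?thesis by simp
    qed
  next
    case empty
    then show ?case by simp
  next
    case (compl A)
    have A: "A \<in> sets (interval_measure F)"
      using compl(1) by (simp add: borel_sigma_sets_Ioc)
    have fin: "emeasure (interval_measure F) (A \<inter> {a<..b}) \<noteq> \<infinity>"
    proof -
      have "emeasure (interval_measure F) (A \<inter> {a<..b}) \<le> emeasure (interval_measure F) {a<..b}"
        by (rule emeasure_mono) auto
      then show ?thesis
        by (auto simp: Ioc[OF ab] top_unique)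
    qed
    have add: "ecard (S x \<inter> {a<..b}) = ecard (S x \<inter> (A \<inter> {a<..b})) + ecard (S x \<inter> ((UNIV
        - A) \<inter> {a<..b}))" for x
    proof -
      have "S x \<inter> {a<..b} = (S x \<inter> (A \<inter> {a<..b})) \<union> (S x \<inter> ((UNIV - A) \<inter> {a<..b}))"
        by blast
      then show ?thesis
        by (rule ssubst) (rule ecard_Un, blast)
    qed
    \<comment> \<open>Subtraction is legitimate only where the counts are finite, hence the equation
      holds almost everywhere and measurability passes through completeness.\<close>
    have ae: "AE x in lebesgue. ecard (S x \<inter> {a<..b}) - ecard (S x \<inter> (A \<inter> {a<..b}))
        = ecard (S x \<inter> ((UNIV - A) \<inter> {a<..b}))"
      using AE_finite[OF ab]
    proof eventually_elim
      fix x assume "finite (S x \<inter> {a<..b})"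
      then have "ecard (S x \<inter> (A \<inter> {a<..b})) \<noteq> top"
        by (simp add: ecard_eq_top_iff) (metis Int_left_commute finite_Int)
      then show "ecard (S x \<inter> {a<..b}) - ecard (S x \<inter> (A \<inter> {a<..b}))
          = ecard (S x \<inter> ((UNIV - A) \<inter> {a<..b}))"
        unfolding add[of x] by simp
    qed
    note [measurable] = meas[OF ab] conjunct1[OF compl(2)]
    have "(\<lambda>x. ecard (S x \<inter> {a<..b})
        - ecard (S x \<inter> (A \<inter> {a<..b}))) \<in> borel_measurable lebesgue"
      by measurable
    then have "(\<lambda>x. ecard (S x \<inter> ((UNIV - A) \<inter> {a<..b}))) \<in> borel_measurable lebesgue"
      using ae by (rule borel_measurable_completion_AE)
    moreover have "(\<integral>\<^sup>+x. ecard (S x \<inter> ((UNIV - A) \<inter> {a<..b})) \<partial>lebesgue) =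
        emeasure (interval_measure F) ((UNIV - A) \<inter> {a<..b})"
    proof -
      have "(\<integral>\<^sup>+x. ecard (S x \<inter> ((UNIV - A) \<inter> {a<..b})) \<partial>lebesgue) =
          (\<integral>\<^sup>+x. ecard (S x \<inter> {a<..b})
              - ecard (S x \<inter> (A \<inter> {a<..b})) \<partial>lebesgue)"
        using ae by (intro nn_integral_cong_AE) (auto elim: eventually_mono)
      also have "\<dots> = (\<integral>\<^sup>+x. ecard (S x \<inter> {a<..b}) \<partial>lebesgue)
          - (\<integral>\<^sup>+x. ecard (S x \<inter> (A \<inter> {a<..b})) \<partial>lebesgue)"
        using fin compl(2) by (intro nn_integral_diff AE_I2 ecard_mono) auto
      also have "\<dots> = emeasure (interval_measure F) {a<..b} - emeasure (interval_measure F) (A \<inter> {a<..b})"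
        using compl(2) by (simp add: int[OF ab] Ioc[OF ab])
      also have "\<dots> = emeasure (interval_measure F) ({a<..b} - A \<inter> {a<..b})"
        using A fin by (intro emeasure_Diff[symmetric]) auto
      also have "{a<..b} - A \<inter> {a<..b} = (UNIV - A) \<inter> {a<..b}"
        by blast
      finally show ?thesis .
    qed
    ultimately show ?case by blast
  next
    case (union A)
    have A: "A i \<in> sets (interval_measure F)" for i
      using union(2) by (auto simp: borel_sigma_sets_Ioc)
    note [measurable] = conjunct1[OF union(3)]
    have eq: "ecard (S x \<inter> ((\<Union>i. A i) \<inter> {a<..b}))
        = (\<Sum>i. ecard (S x \<inter> (A i \<inter> {a<..b})))" for x
    proof -
      have "disjoint_family (\<lambda>i. S x \<inter> (A i \<inter> {a<..b}))"
        using union(1) by (auto simp: disjoint_family_on_def)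
      then have "(\<Sum>i. ecard (S x \<inter> (A i \<inter> {a<..b})))
          = ecard (\<Union>i. S x \<inter> (A i \<inter> {a<..b}))"
        by (intro suminf_emeasure) auto
      also have "(\<Union>i. S x \<inter> (A i \<inter> {a<..b})) = S x \<inter> ((\<Union>i. A i) \<inter> {a<..b})"
        by blast
      finally show ?thesis by simp
    qed
    have "(\<Sum>i. emeasure (interval_measure F) (A i \<inter> {a<..b})) =
        emeasure (interval_measure F) (\<Union>i. A i \<inter> {a<..b})"
      using A union(1) by (intro suminf_emeasure) (auto simp: disjoint_family_on_def)
    also have "(\<Union>i. A i \<inter> {a<..b}) = (\<Union>i. A i) \<inter> {a<..b}"
      by blast
    finally have "(\<integral>\<^sup>+x. (\<Sum>i. ecard (S x \<inter> (A i \<inter> {a<..b}))) \<partial>lebesgue) =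
        emeasure (interval_measure F) ((\<Union>i. A i) \<inter> {a<..b})"
      using union(3) by (subst nn_integral_suminf) auto
    moreover have "(\<lambda>x. \<Sum>i. ecard (S x \<inter> (A i \<inter> {a<..b}))) \<in> borel_measurable lebesgue"
      by measurable
    ultimately show ?case
      unfolding eq by blast
  qed
qed

text \<open>As \<open>V s = x\<close> for \<open>s \<in> S x\<close>, restricting the times to
  \<open>occ_set V t A\<close> amounts to restricting the level to \<open>A\<close>. This turns a
  measure of times into an integral over levels.\<close>

lemma occupation_integral:
  assumes t: "0 \<le> t" and A: "A \<in> sets borel" and B: "occ_set V t A \<in> sets borel"
    and S: "\<And>x s. s \<in> S x \<Longrightarrow> V s = x"
  shows "set_integrable lebesgue A (\<lambda>x. real (card (S x \<inter> {0<..t})))" (is ?int)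
    and "(LINT x:A|lebesgue. real (card (S x \<inter> {0<..t}))) = measure (interval_measure F) (occ_set V t A)"
proof -
  have occ: "occ_set V t A \<inter> {0<..t} = occ_set V t A"
    by (auto simp: occ_set_def)
  let ?f = "\<lambda>x. ecard (S x \<inter> occ_set V t A)"
  have f [measurable]: "?f \<in> borel_measurable lebesgue"
    and int_f: "(\<integral>\<^sup>+x. ?f x \<partial>lebesgue) = emeasure (interval_measure F) (occ_set V t A)"
    using Borel[OF B t] by (simp_all add: occ)
  \<comment> \<open>Valid also for infinite sets: \<open>card\<close> is 0 there, and so is
    \<open>enn2real top\<close>.\<close>
  have eq: "indicator A x *\<^sub>R real (card (S x \<inter> {0<..t})) = enn2real (?f x)" for x
  proof -
    have "S x \<inter> occ_set V t A = (if x \<in> A then S x \<inter> {0<..t} else {})"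
      using S by (auto simp: occ_set_def)
    then show ?thesis
      by (simp add: card_eq_enn2real indicator_def)
  qed
  have "emeasure (interval_measure F) (occ_set V t A) \<le> emeasure (interval_measure F) {0<..t}"
    by (rule emeasure_mono) (auto simp: occ_set_def)
  then have fin: "emeasure (interval_measure F) (occ_set V t A) < \<infinity>"
    using Ioc[OF t] by (simp add: le_less_trans)
  have "AE x in lebesgue. ?f x \<noteq> \<infinity>"
    using fin by (intro nn_integral_PInf_AE) (auto simp: int_f)
  then have "AE x in lebesgue. ennreal (enn2real (?f x)) = ?f x"
    by eventually_elim (simp add: less_top)
  then have int: "(\<integral>\<^sup>+x. ennreal (enn2real (?f x)) \<partial>lebesgue)
      = emeasure (interval_measure F) (occ_set V t A)"
    using int_f by (simp add: nn_integral_cong_AE)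
  show ?int
    unfolding set_integrable_def eq using fin
    by (intro integrableI_nonneg) (auto simp: int)
  show "(LINT x:A|lebesgue. real (card (S x \<inter> {0<..t}))) = measure (interval_measure F) (occ_set V t A)"
    unfolding set_lebesgue_integral_def eq
    by (subst integral_eq_nn_integral) (auto simp: int measure_def)
qed

end

subsection \<open>Jumps and variation\<close>

text \<open>Integrating the number of upcrossings over the level gives this sum. For
  \<open>\<lambda>s. - f s\<close> it is the sum of the negative parts of the increments.\<close>

definition pos_sum :: "(real \<Rightarrow> real) \<Rightarrow> real \<Rightarrow> real \<Rightarrow> nat \<Rightarrow> real" where
  "pos_sum f a b n = (\<Sum>k<2 ^ n. max 0 (f (grid a b n (Suc k)) - f (grid a b n k)))"

lemma pos_sum_diff: "pos_sum f a b n - pos_sum (\<lambda>s. - f s) a b n = f b - f a"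
proof -
  have "pos_sum f a b n - pos_sum (\<lambda>s. - f s) a b n = (\<Sum>k<2 ^ n. f (grid a b n (Suc k)) - f (grid a b n k))"
    unfolding pos_sum_def sum_subtractf[symmetric] by (intro sum.cong) auto
  then show ?thesis
    using sum_lessThan_telescope[of "\<lambda>k. f (grid a b n k)" "2 ^ n"] by simp
qed

lemma pos_sum_add:
  "pos_sum f a b n + pos_sum (\<lambda>s. - f s) a b n = (\<Sum>k<2 ^ n. \<bar>f (grid a b n (Suc k))
      - f (grid a b n k)\<bar>)"
  unfolding pos_sum_def sum.distrib[symmetric] by (intro sum.cong) auto

lemma pos_sum_nonneg: "0 \<le> pos_sum f a b n"
  by (auto simp: pos_sum_def intro!: sum_nonneg)

lemma grid_sum_le_variation:
  assumes bv: "bounded_variation_on f c d" and ab: "c \<le> a" "a < b" "b \<le> d"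
  shows "(\<Sum>k<2 ^ n. \<bar>f (grid a b n (Suc k)) - f (grid a b n k)\<bar>) \<le> variation f c d"
proof -
  let ?xs = "map (grid a b n) [0..<Suc (2 ^ n)]"
  have "sorted ?xs"
    by (simp add: sorted_iff_nth_mono grid_le_iff[OF ab(2)] nth_append less_Suc_eq_le del: upt_Suc)
  moreover have "set ?xs \<subseteq> {c..d}"
  proof
    fix y assume "y \<in> set ?xs"
    then obtain k where "k \<le> 2 ^ n" "y = grid a b n k"
      by (auto simp: less_Suc_eq_le simp del: upt_Suc)
    then show "y \<in> {c..d}"
      using grid_ge[of a b n k] grid_le[of a b k n] ab by auto
  qed
  moreover have "partition_sum f ?xs = (\<Sum>k<2 ^ n. \<bar>f (grid a b n (Suc k)) - f (grid a b n k)\<bar>)"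
    unfolding partition_sum_def by (intro sum.cong) (auto simp del: upt_Suc)
  ultimately have "(\<Sum>k<2 ^ n. \<bar>f (grid a b n (Suc k)) - f (grid a b n k)\<bar>) \<in> partition_sums f c d"
    unfolding partition_sums_def by (metis (mono_tags, lifting) image_eqI mem_Collect_eq)
  then show ?thesis
    using bv unfolding variation_def bounded_variation_on_def by (rule cSup_upper)
qed

lemma (in cadlag_path) isCont_iff_jump: "0 < s \<Longrightarrow> isCont V s \<longleftrightarrow> jump V s = 0"
proof
  assume s: "0 < s" and "isCont V s"
  then have "(V \<longlongrightarrow> V s) (at_left s)"
    by (simp add: isCont_def filterlim_at_split)
  then have "left_lim V s = V s"
    unfolding left_lim_def by (intro tendsto_Lim) auto
  then show "jump V s = 0"
    by (simp add: jump_def)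
next
  assume s: "0 < s" and "jump V s = 0"
  then show "isCont V s"
    using left_lim[OF s] right_cont[of s] by (simp add: isCont_def filterlim_at_split jump_def)
qed

lemma (in cadlag_path) jump_uminus: "0 < s \<Longrightarrow> jump (\<lambda>s. - V s) s = - jump V s"
  using tendsto_minus[OF left_lim, of s] by (simp add: jump_def left_lim_def tendsto_Lim)

text \<open>The cells shrink to \<open>s\<close>. Their left ends are strictly before
  \<open>s\<close> and see the left limit; their right ends are after \<open>s\<close> or equal to
  it, and right continuity gives \<open>V s\<close> in either case.\<close>

lemma (in cadlag_path) cell_limits:
  assumes s: "0 < s" and ab: "0 \<le> a" "a < b"
    and c: "\<And>n. grid a b n (c n) < s" "\<And>n. s \<le> grid a b n (Suc (c n))"
  shows "(\<lambda>n. V (grid a b n (Suc (c n))) - V (grid a b n (c n))) \<longlonglongrightarrow> jump V s"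
  unfolding jump_def
proof (rule tendsto_diff)
  have lo: "s - (b - a) / 2 ^ n \<le> grid a b n (c n)" for n
    using c(2)[of n] by (simp add: grid_Suc)
  have hi: "grid a b n (Suc (c n)) \<le> s + (b - a) / 2 ^ n" for n
    using c(1)[of n] by (simp add: grid_Suc)
  have "(\<lambda>n. s - (b - a) / 2 ^ n) \<longlonglongrightarrow> s - 0" "(\<lambda>n. s + (b - a) / 2 ^ n)
      \<longlonglongrightarrow> s + 0"
    by (intro tendsto_diff tendsto_add tendsto_const mesh_tendsto_0)+
  then have lims: "(\<lambda>n. s - (b - a) / 2 ^ n) \<longlonglongrightarrow> s" "(\<lambda>n. s + (b - a) / 2 ^ n)
      \<longlonglongrightarrow> s"
    by simp_all
  have l: "(\<lambda>n. grid a b n (c n)) \<longlonglongrightarrow> s"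
    by (rule tendsto_sandwich[OF _ _ lims(1) tendsto_const])
      (use lo less_imp_le[OF c(1)] in auto)
  have r: "(\<lambda>n. grid a b n (Suc (c n))) \<longlonglongrightarrow> s"
    by (rule tendsto_sandwich[OF _ _ tendsto_const lims(2)]) (use hi c(2) in auto)
  have "filterlim (\<lambda>n. grid a b n (c n)) (at_left s) sequentially"
    unfolding filterlim_at using l c(1) by (auto intro!: always_eventually) 
  then show "(\<lambda>n. V (grid a b n (c n))) \<longlonglongrightarrow> left_lim V s"
    by (rule filterlim_compose[OF left_lim[OF s]])
  show "(\<lambda>n. V (grid a b n (Suc (c n)))) \<longlonglongrightarrow> V s"
  proof (rule order_tendstoI)
    fix y assume y: "y < V s"
    then obtain w where w: "s < w" "\<And>u. s < u \<Longrightarrow> u < w \<Longrightarrow> y < V u"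
      using above_on_right[of s y] s by auto
    show "\<forall>\<^sub>F n in sequentially. y < V (grid a b n (Suc (c n)))"
      using order_tendstoD(2)[OF r w(1)]
    proof eventually_elim
      fix n assume "grid a b n (Suc (c n)) < w"
      then show "y < V (grid a b n (Suc (c n)))"
        using c(2)[of n] w(2) y by (cases "s = grid a b n (Suc (c n))") auto
    qed
  next
    fix y assume y: "V s < y"
    then obtain w where w: "s < w" "\<And>u. s < u \<Longrightarrow> u < w \<Longrightarrow> V u < y"
      using below_on_right[of s y] s by auto
    show "\<forall>\<^sub>F n in sequentially. V (grid a b n (Suc (c n))) < y"
      using order_tendstoD(2)[OF r w(1)]
    proof eventually_elim
      fix n assume "grid a b n (Suc (c n)) < w"
      then show "V (grid a b n (Suc (c n))) < y"
        using c(2)[of n] w(2) y by (cases "s = grid a b n (Suc (c n))") auto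
    qed
  qed
qed

text \<open>The sign e allows the results on increases of the path to be applied to the reflected path
  without a change of variables in the level.\<close>

locale bv_path = cadlag_path +
  fixes e :: real
  assumes bv: "T \<ge> 0 \<Longrightarrow> bounded_variation_on V 0 T"
    and e: "e = 1 \<or> e = - 1"
begin

text \<open>Each jump is the limit of the increments over the cells containing its time. On a fine
  grid the points of \<open>F\<close> lie in distinct cells, so these increments form part of one
  grid sum.\<close>

lemma sum_jump_le_variation:
  assumes b: "0 < b" and F: "finite F" "F \<subseteq> {0<..b}"
  shows "(\<Sum>s\<in>F. \<bar>jump V s\<bar>) \<le> variation V 0 b"
proof -
  have "\<exists>k<2 ^ n. grid 0 b n k < s \<and> s \<le> grid 0 b n (Suc k)" if "s \<in> F" for s n
    by (rule grid_cell[OF b, of s n]) (use that F in auto)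
  then obtain c where c: "\<And>s n. s \<in> F \<Longrightarrow> c s n < 2 ^ n \<and> grid 0 b n (c s n) < s \<and> s
      \<le> grid 0 b n (Suc (c s n))"
    by metis
  let ?D = "\<lambda>n k. \<bar>V (grid 0 b n (Suc k)) - V (grid 0 b n k)\<bar>"
  have "(\<lambda>n. \<Sum>s\<in>F. ?D n (c s n)) \<longlonglongrightarrow> (\<Sum>s\<in>F. \<bar>jump V s\<bar>)"
    using F b c by (intro tendsto_intros cell_limits) auto
  moreover have "\<forall>\<^sub>F n in sequentially. (\<Sum>s\<in>F. ?D n (c s n)) \<le> variation V 0 b"
  proof -
    have "\<forall>\<^sub>F n in sequentially. s \<noteq> s' \<longrightarrow> (b - 0) / 2 ^ n < \<bar>s - s'\<bar>" for s s'
    proof (cases "s = s'")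
      case False
      have "\<forall>\<^sub>F n in sequentially. (b - 0) / 2 ^ n < \<bar>s - s'\<bar>"
        using False by (intro order_tendstoD(2)[OF mesh_tendsto_0]) auto
      then show ?thesis by eventually_elim simp
    qed simp
    then have "\<forall>\<^sub>F n in sequentially. \<forall>s\<in>F. \<forall>s'\<in>F. s \<noteq> s' \<longrightarrow> (b - 0) / 2 ^ n < \<bar>s - s'\<bar>"
      using F by (intro eventually_ball_finite ballI) auto
    then show ?thesis
    proof eventually_elim
      fix n assume n: "\<forall>s\<in>F. \<forall>s'\<in>F. s \<noteq> s' \<longrightarrow> (b - 0) / 2 ^ n < \<bar>s
          - s'\<bar>"
      have inj: "inj_on (\<lambda>s. c s n) F"
      proof (rule inj_onI, rule ccontr)
        fix s s' assume s: "s \<in> F" "s' \<in> F" "c s n = c s' n" "s \<noteq> s'"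
        then have "b / 2 ^ n < \<bar>s - s'\<bar>" using n by auto
        then show False
          using c[OF s(1), of n] c[OF s(2), of n] s(3) by (auto simp: grid_Suc abs_if split: if_splits)
      qed
      have "(\<Sum>s\<in>F. ?D n (c s n)) = (\<Sum>k\<in>(\<lambda>s. c s n) ` F. ?D n k)"
        by (simp add: sum.reindex[OF inj])
      also have "\<dots> \<le> (\<Sum>k<2 ^ n. ?D n k)"
        using c by (intro sum_mono2) auto
      also have "\<dots> \<le> variation V 0 b"
        using b by (intro grid_sum_le_variation bv) auto
      finally show "(\<Sum>s\<in>F. ?D n (c s n)) \<le> variation V 0 b" .
    qed
  qed
  ultimately show ?thesis
    by (rule tendsto_upperbound) simp
qed

lemma jump_abs_summable: "0 \<le> a \<Longrightarrow> (\<lambda>s. \<bar>jump V s\<bar>) summable_on {a<..b}"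
proof -
  assume a: "0 \<le> a"
  \<comment> \<open>The maximum with 1 secures the positive endpoint that the variation bound asks
    for.\<close>
  have "(\<lambda>s. \<bar>jump V s\<bar>) summable_on {0<..max b 1}"
  proof (rule nonneg_bdd_above_summable_on)
    show "bdd_above (sum (\<lambda>s. \<bar>jump V s\<bar>) ` {F. F \<subseteq> {0<..max b 1} \<and> finite F})"
    proof (rule bdd_aboveI2)
      fix F assume "F \<in> {F. F \<subseteq> {0<..max b 1} \<and> finite F}"
      then show "(\<Sum>s\<in>F. \<bar>jump V s\<bar>) \<le> variation V 0 (max b 1)"
        by (intro sum_jump_le_variation) auto
    qed
  qed auto
  then show ?thesis
    by (rule summable_on_subset_banach) (use a in auto)
qed

lemma jump_summable: "0 \<le> a \<Longrightarrow> jump V summable_on {a<..b}"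
  by (rule summable_on_iff_abs_summable_on_real[THEN iffD2]) (simp add: jump_abs_summable)

lemma pos_jump_summable: "0 \<le> a \<Longrightarrow> (\<lambda>s. max 0 (jump V s)) summable_on {a<..b}"
  by (rule summable_on_comparison_test[OF jump_abs_summable]) auto

lemma countable_jumps: "0 \<le> a \<Longrightarrow> countable {s \<in> {a<..b}. jump V s \<noteq> 0}"
  by (rule summable_countable_real[OF jump_summable])

definition up_jumps :: "real \<Rightarrow> real set" where
  "up_jumps x = {s. jump V s \<noteq> 0 \<and> left_lim V s < x \<and> x < V s}"

text \<open>At an up time the left limit is at most \<open>x\<close> and the value at least
  \<open>x\<close>. Without a jump both equal \<open>x\<close>; with a jump both inequalities are
  strict because \<open>x\<close> avoids the ends of jumps.\<close>

lemma up_times_eq: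
  assumes a: "0 \<le> a"
    and x: "x \<notin> V ` {s \<in> {a<..b}. jump V s \<noteq> 0}" "x \<notin> left_lim V ` {s \<in> {a<..b}. jump V s \<noteq> 0}"
  shows "up_times V x \<inter> {a<..b} = ({s. incr_through V x s} \<inter> {a<..b}) \<union> (up_jumps x \<inter> {a<..b})"
proof (intro set_eqI iffI)
  fix s assume s: "s \<in> up_times V x \<inter> {a<..b}"
  then obtain \<delta> where \<delta>: "\<delta> > 0" "\<And>u. 0 \<le> u \<Longrightarrow> s - \<delta> < u
      \<Longrightarrow> u < s \<Longrightarrow> V u < x"
    "\<And>u. s < u \<Longrightarrow> u < s + \<delta> \<Longrightarrow> x < V u" and Vs: "x \<le> V s" and s0: "0 < s"
    by (auto simp: up_times_def)
  have "\<forall>\<^sub>F u in at_left s. V u \<le> x"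
    unfolding eventually_at_left_field
    by (rule exI[of _ "max 0 (s - \<delta>)"]) (use \<delta>(1,2) s0 in \<open>auto intro: less_imp_le\<close>)
  then have le: "left_lim V s \<le> x"
    by (intro tendsto_upperbound[OF left_lim[OF s0]]) auto
  show "s \<in> ({s. incr_through V x s} \<inter> {a<..b}) \<union> (up_jumps x \<inter> {a<..b})"
  proof (cases "jump V s = 0")
    case True
    then have "V s = x" using le Vs by (simp add: jump_def)
    moreover have "isCont V s" using True s0 by (simp add: isCont_iff_jump)
    moreover have "sgn (V u - V s) = sgn (u - s)" if u: "0 \<le> u" "0 < \<bar>u - s\<bar>" "\<bar>u
        - s\<bar> < \<delta>" for u
    proof (cases "u < s")
      case True
      then show ?thesis
        using \<delta>(2)[of u] u \<open>V s = x\<close> by simp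
    next
      case False
      then show ?thesis
        using \<delta>(3)[of u] u \<open>V s = x\<close> by simp
    qed
    ultimately have "incr_through V x s"
      unfolding incr_through_def using s0 \<delta>(1) by blast
    then show ?thesis using s by auto
  next
    case False
    have "s \<in> {s \<in> {a<..b}. jump V s \<noteq> 0}"
      using s False by simp
    then have "x \<noteq> V s" "x \<noteq> left_lim V s"
      using x by blast+
    then show ?thesis
      using s False le Vs by (auto simp: up_jumps_def)
  qed
next
  fix s assume s: "s \<in> ({s. incr_through V x s} \<inter> {a<..b}) \<union> (up_jumps x \<inter> {a<..b})"
  then have s0: "0 < s" using a by auto
  from s show "s \<in> up_times V x \<inter> {a<..b}"
  proof
    assume *: "s \<in> {s. incr_through V x s} \<inter> {a<..b}"
    then obtain \<delta> where \<delta>: "\<delta> > 0"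
      "\<And>u. u \<ge> 0 \<Longrightarrow> 0 < \<bar>u - s\<bar> \<Longrightarrow> \<bar>u - s\<bar> < \<delta>
          \<Longrightarrow> sgn (V u - V s) = sgn (u - s)" and Vs: "V s = x"
      by (auto simp: incr_through_def)
    have "V u < x" if "0 \<le> u" "s - \<delta> < u" "u < s" for u
      using \<delta>(2)[of u] that Vs by (auto simp: sgn_if split: if_splits)
    moreover have "x < V u" if "s < u" "u < s + \<delta>" for u
      using \<delta>(2)[of u] that Vs s0 by (auto simp: sgn_if split: if_splits)
    ultimately show ?thesis
      using * Vs s0 \<delta>(1) by (auto simp: up_times_def)
  next
    assume *: "s \<in> up_jumps x \<inter> {a<..b}"
    then have lt: "left_lim V s < x" "x < V s" by (auto simp: up_jumps_def)
    obtain l where l: "l < s" "\<And>u. l < u \<Longrightarrow> u < s \<Longrightarrow> V u < x"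
      using order_tendstoD(2)[OF left_lim[OF s0] lt(1)] by (auto simp: eventually_at_left_field)
    obtain r where r: "s < r" "\<And>u. s < u \<Longrightarrow> u < r \<Longrightarrow> x < V u"
      using above_on_right[OF _ lt(2)] s0 by auto
    show ?thesis
      using * lt s0 l r by (auto simp: up_times_def intro!: exI[of _ "min (s - l) (r - s)"])
  qed
qed

lemma ecard_up_times:
  assumes a: "0 \<le> a"
    and x: "x \<notin> V ` {s \<in> {a<..b}. jump V s \<noteq> 0}" "x \<notin> left_lim V ` {s \<in> {a<..b}. jump V s \<noteq> 0}"
  shows "ecard (up_times V x \<inter> {a<..b}) = ecard ({s. incr_through V x s} \<inter> {a<..b})
      + ecard (up_jumps x \<inter> {a<..b})"
  unfolding up_times_eq[OF assms]
  by (rule ecard_Un) (auto simp: incr_through_def up_jumps_def isCont_iff_jump)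

end

subsection \<open>Integration over the level\<close>

lemma nn_integral_count_space_eq_infsum:
  fixes f :: "'a \<Rightarrow> real"
  assumes "f summable_on A" "\<And>x. x \<in> A \<Longrightarrow> 0 \<le> f x"
  shows "(\<integral>\<^sup>+x. ennreal (f x) \<partial>count_space A) = ennreal (infsum f A)"
proof -
  have "Infinite_Set_Sum.abs_summable_on f A"
    using assms(1) summable_on_iff_abs_summable_on_real[of f A] abs_summable_equivalent by blast
  then show ?thesis
    using nn_integral_conv_infsetsum[of f A] assms(2) by (simp add: infsetsum_infsum)
qed

context bv_path
begin

lemma level_band_eq: "{x. p < e * x \<and> e * x < q} = (if e = 1 then {p<..<q} else {- q<..<- p})"
  using e by auto

lemma level_band_borel [measurable]: "{x. p < e * x \<and> e * x < q} \<in> sets borel"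
  by (simp add: level_band_eq)

text \<open>Reflection by \<open>e\<close> preserves length. For \<open>q < p\<close> the band is
  empty and \<open>ennreal (q - p)\<close> is 0.\<close>

lemma emeasure_level_band: "emeasure lebesgue {x. p < e * x \<and> e * x < q} = ennreal (q - p)"
proof -
  have "emeasure lebesgue {x. p < e * x \<and> e * x < q} = emeasure lborel {x. p < e * x \<and> e * x < q}"
    using level_band_borel by simp
  also have "\<dots> = ennreal (q - p)"
    unfolding level_band_eq
    by (cases "p \<le> q") (auto simp: ennreal_neg)
  finally show ?thesis .
qed

lemma AE_level_notin:
  assumes "countable C"
  shows "AE x in lebesgue. e * x \<notin> C"
proof -
  have "{x. e * x \<in> C} = (\<lambda>y. e * y) ` C"
    using e by (auto simp: image_iff) (metis minus_minus mult_minus1)+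
  then have "countable {x. e * x \<in> C}"
    using assms by simp
  then have "{x. e * x \<in> C} \<in> null_sets lborel"
    by (rule countable_imp_null_set_lborel)
  then have "AE x in lborel. x \<notin> {x. e * x \<in> C}"
    by (rule AE_not_in)
  then show ?thesis
    by (intro AE_completion) simp
qed

text \<open>By Tonelli the count can be integrated jump by jump: an upward jump at \<open>s\<close>
  crosses a band of levels of length \<open>jump V s\<close>, a downward one is counted at no
  level.\<close>

lemma up_jumps_integral:
  assumes a: "0 \<le> a"
  shows "(\<lambda>x. ecard (up_jumps (e * x) \<inter> {a<..b})) \<in> borel_measurable lebesgue" (is ?meas)
    and "(\<integral>\<^sup>+x. ecard (up_jumps (e * x) \<inter> {a<..b}) \<partial>lebesgue) =
      ennreal (\<Sum>\<^sub>\<infinity>s\<in>{a<..b}. max 0 (jump V s))"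
proof -
  \<comment> \<open>The countable set of jump times replaces \<open>{a<..b}\<close>, so that the
    counting measure is sigma-finite.\<close>
  define D where "D = {s \<in> {a<..b}. jump V s \<noteq> 0}"
  define B where "B s = {x. left_lim V s < e * x \<and> e * x < V s}" for s
  have D: "countable D"
    using countable_jumps[OF a] by (simp add: D_def)
  have [measurable]: "B s \<in> sets lebesgue" for s
    using level_band_borel by (simp add: B_def)
  have eq: "ecard (up_jumps (e * x) \<inter> {a<..b})
      = (\<integral>\<^sup>+s. indicator (B s) x \<partial>count_space D)" for x
  proof -
    have sub: "up_jumps (e * x) \<inter> {a<..b} \<subseteq> D"
      by (auto simp: up_jumps_def D_def)
    have "(\<integral>\<^sup>+s. indicator (B s) x \<partial>count_space D) =
        (\<integral>\<^sup>+s. indicator (up_jumps (e * x) \<inter> {a<..b}) s \<partial>count_space D)"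
      by (rule nn_integral_cong) (auto simp: B_def D_def up_jumps_def split: split_indicator)
    also have "\<dots> = emeasure (count_space D) (up_jumps (e * x) \<inter> {a<..b})"
      using sub by (intro nn_integral_indicator) auto
    also have "\<dots> = ecard (up_jumps (e * x) \<inter> {a<..b})"
      using sub by (simp add: emeasure_count_space)
    finally show ?thesis by simp
  qed
  interpret D: sigma_finite_measure "count_space D"
    using D by (rule sigma_finite_measure_count_space_countable)
  have "(\<lambda>(x, s). indicator (B s) x :: ennreal) \<in> borel_measurable (lebesgue \<Otimes>\<^sub>M count_space D)"
    using measurable_pair_swap[OF measurable_pair_measure_countable1[OF D,
        of "\<lambda>(s, x). indicator (B s) x :: ennreal" lebesgue borel]] by simp
  then show ?meas
    unfolding eq by (rule D.borel_measurable_nn_integral)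
  have "(\<integral>\<^sup>+x. ecard (up_jumps (e * x) \<inter> {a<..b}) \<partial>lebesgue) =
      (\<integral>\<^sup>+s. \<integral>\<^sup>+x. indicator (B s) x \<partial>lebesgue \<partial>count_space D)"
    unfolding eq using D by (rule nn_integral_count_space_nn_integral) simp
  also have "\<dots> = (\<integral>\<^sup>+s. ennreal (max 0 (jump V s)) \<partial>count_space D)"
    by (intro nn_integral_cong) (simp add: B_def emeasure_level_band jump_def max_def ennreal_neg)
  also have "\<dots> = (\<integral>\<^sup>+s. ennreal (max 0 (jump V s)) \<partial>count_space {a<..b})"
    by (rule nn_integral_count_space_eq) (auto simp: D_def)
  also have "\<dots> = ennreal (\<Sum>\<^sub>\<infinity>s\<in>{a<..b}. max 0 (jump V s))"
    by (rule nn_integral_count_space_eq_infsum[OF pos_jump_summable[OF a]]) simp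
  finally show "(\<integral>\<^sup>+x. ecard (up_jumps (e * x) \<inter> {a<..b}) \<partial>lebesgue) =
      ennreal (\<Sum>\<^sub>\<infinity>s\<in>{a<..b}. max 0 (jump V s))" .
qed

text \<open>A cell is an upcrossing of exactly the levels in the open band from its left value up to
  its right value; the length of the band is the positive part of the increment.\<close>

lemma upcrossings_integral:
  shows "(\<lambda>x. of_nat (card (upcrossings V a b n (e * x))) :: ennreal) \<in> borel_measurable lebesgue" (is ?meas)
    and "(\<integral>\<^sup>+x. of_nat (card (upcrossings V a b n (e * x))) \<partial>lebesgue) = ennreal (pos_sum V a b n)"
proof -
  define B where "B k = {x. V (grid a b n k) < e * x \<and> e * x < V (grid a b n (Suc k))}" for k
  have [measurable]: "B k \<in> sets lebesgue" for k
    using level_band_borel by (simp add: B_def)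
  have eq: "of_nat (card (upcrossings V a b n (e * x))) = (\<Sum>k<2 ^ n. indicator (B k) x :: ennreal)" for x
  proof -
    have "(\<Sum>k<2 ^ n. indicator (B k) x :: ennreal) = (\<Sum>k<2 ^ n. indicator (upcrossings V a b n (e * x)) k)"
      by (intro sum.cong) (auto simp: B_def upcrossings_def split: split_indicator)
    also have "\<dots> = of_nat (card ({..<2 ^ n} \<inter> upcrossings V a b n (e * x)))"
      by (simp add: indicator_def sum_of_bool_eq)
    also have "{..<2 ^ n} \<inter> upcrossings V a b n (e * x) = upcrossings V a b n (e * x)"
      by (auto simp: upcrossings_def)
    finally show ?thesis by simp
  qed
  show ?meas
    unfolding eq by measurable
  have "(\<integral>\<^sup>+x. of_nat (card (upcrossings V a b n (e * x))) \<partial>lebesgue)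
      = (\<Sum>k<2 ^ n. emeasure lebesgue (B k))"
    unfolding eq by (subst nn_integral_sum) auto
  also have "\<dots> = (\<Sum>k<2 ^ n. ennreal (max 0 (V (grid a b n (Suc k)) - V (grid a b n k))))"
    by (intro sum.cong) (simp_all add: B_def emeasure_level_band max_def ennreal_neg)
  also have "\<dots> = ennreal (pos_sum V a b n)"
    unfolding pos_sum_def by (rule sum_ennreal) simp
  finally show "(\<integral>\<^sup>+x. of_nat (card (upcrossings V a b n (e * x))) \<partial>lebesgue)
      = ennreal (pos_sum V a b n)" .
qed

end

lemma bounded_variation_on_uminus: "bounded_variation_on (\<lambda>s.
    - f s) a b \<longleftrightarrow> bounded_variation_on f a b"
proof -
  have "partition_sum (\<lambda>s. - f s) xs = partition_sum f xs" for xs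
    unfolding partition_sum_def by (intro sum.cong) (auto simp: abs_minus_commute)
  then show ?thesis
    by (simp add: bounded_variation_on_def partition_sums_def cong: image_cong)
qed

text \<open>Level \<open>e * x\<close> of \<open>V\<close> is level \<open>- e * x\<close> of
  \<open>\<lambda>s. - V s\<close>: flipping both signs keeps the integration variable
  \<open>x\<close> and exchanges upcrossings with downcrossings.\<close>

lemma (in bv_path) bv_path_uminus: "bv_path (\<lambda>s. - V s) (- e)"
proof
  show "cadlag (\<lambda>s. - V s)"
    using cadlag by (auto simp: cadlag_def intro!: continuous_minus) (metis tendsto_minus)
qed (use e bv in \<open>auto simp: bounded_variation_on_uminus\<close>)

lemma ennreal_real_add: "ennreal (real (m + n)) = of_nat m + of_nat n"
  by (metis ennreal_of_nat_eq_real_of_nat of_nat_add)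

section \<open>Limits of the crossing counts\<close>

context bv_path
begin

interpretation neg: bv_path "\<lambda>s. - V s" "- e"
  by (rule bv_path_uminus)

lemma downcrossings_integral:
  shows "(\<lambda>x. of_nat (card (downcrossings V a b n (e * x))) :: ennreal) \<in> borel_measurable lebesgue"
    and "(\<integral>\<^sup>+x. of_nat (card (downcrossings V a b n (e * x))) \<partial>lebesgue)
        = ennreal (pos_sum (\<lambda>s. - V s) a b n)"
  using neg.upcrossings_integral[of a b n] by (simp_all add: downcrossings_eq)

text \<open>The dominating function is the supremum over \<open>n\<close>. Away from the countably
  many grid values the counts increase with \<open>n\<close>, so monotone convergence bounds the
  integral of the supremum by the variation.\<close>

lemma crossings_dominated:
  assumes ab: "0 \<le> a" "a < b"
  obtains w where "w \<in> borel_measurable lebesgue" "(\<integral>\<^sup>+x. w x \<partial>lebesgue) < \<infinity>"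
    "\<And>x n. of_nat (card (upcrossings V a b n (e * x))) + of_nat (card (downcrossings V a b n (e * x))) \<le> w x"
proof -
  define f where "f n x = (of_nat (card (upcrossings V a b n (e * x))) +
    of_nat (card (downcrossings V a b n (e * x))) :: ennreal)" for n x
  have [measurable]: "f n \<in> borel_measurable lebesgue" for n
    unfolding f_def by (intro borel_measurable_add upcrossings_integral downcrossings_integral)
  have f_eq: "f n x = ennreal (real_of_int (grid_variation (\<lambda>u. of_bool (V u < e * x)) a b n))"
    if "e * x \<notin> V ` dyadic_points a b" for n x
  proof -
    have "grid_variation (\<lambda>u. of_bool (V u < e * x)) a b n =
        int (card (upcrossings V a b n (e * x)) + card (downcrossings V a b n (e * x)))"
      using card_crossings[OF ab(2) that, of n] by simp
    then show ?thesis
      by (simp only: f_def of_int_of_nat_eq ennreal_real_add)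
  qed
  have "(\<integral>\<^sup>+x. (SUP n. f n x) \<partial>lebesgue) = (SUP n. integral\<^sup>N lebesgue (f n))"
  proof (rule nn_integral_monotone_convergence_SUP_AE)
    fix n
    have "AE x in lebesgue. e * x \<notin> V ` dyadic_points a b"
      by (intro AE_level_notin countable_image countable_dyadic_points)
    then show "AE x in lebesgue. f n x \<le> f (Suc n) x"
      by eventually_elim (auto simp: f_eq intro!: ennreal_leI grid_variation_mono)
  qed simp
  also have "\<dots> \<le> ennreal (variation V 0 b)"
  proof (rule SUP_least)
    fix n
    have "integral\<^sup>N lebesgue (f n) = ennreal (pos_sum V a b n) + ennreal (pos_sum (\<lambda>s. - V s) a b n)"
      unfolding f_def
      by (subst nn_integral_add) (auto intro: upcrossings_integral downcrossings_integral
          simp: upcrossings_integral(2) downcrossings_integral(2))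
    also have "\<dots> = ennreal (pos_sum V a b n + pos_sum (\<lambda>s. - V s) a b n)"
      by (simp add: pos_sum_nonneg)
    also have "\<dots> \<le> ennreal (variation V 0 b)"
      unfolding pos_sum_add using ab by (intro ennreal_leI grid_sum_le_variation bv) auto
    finally show "integral\<^sup>N lebesgue (f n) \<le> ennreal (variation V 0 b)" .
  qed
  finally have fin: "(\<integral>\<^sup>+x. (SUP n. f n x) \<partial>lebesgue) < \<infinity>"
    by (simp add: le_less_trans)
  show ?thesis
  proof (rule that)
    show "(\<lambda>x. SUP n. f n x) \<in> borel_measurable lebesgue"
      by measurable
    show "(\<integral>\<^sup>+x. (SUP n. f n x) \<partial>lebesgue) < \<infinity>"
      by (rule fin)
    show "of_nat (card (upcrossings V a b n (e * x))) + of_nat (card (downcrossings V a b n (e * x))) \<le> (SUP n. f n x)"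
      for x n
      unfolding f_def[symmetric] by (rule SUP_upper) simp
  qed
qed

text \<open>An integrable dominating function is finite almost everywhere, which bounds the sign
  changes uniformly in \<open>n\<close>. The other exceptional levels are grid values and local
  extremal values, a countable set.\<close>

lemma AE_upcrossings_eq:
  assumes ab: "0 \<le> a" "a < b"
  shows "AE x in lebesgue. finite (up_times V (e * x) \<inter> {a<..b}) \<and>
    (\<forall>\<^sub>F n in sequentially. card (upcrossings V a b n (e * x)) = card (up_times V (e * x) \<inter> {a<..b}))"
proof -
  obtain w where w: "w \<in> borel_measurable lebesgue" "(\<integral>\<^sup>+x. w x \<partial>lebesgue) < \<infinity>"
    "\<And>x n. of_nat (card (upcrossings V a b n (e * x))) + of_nat (card (downcrossings V a b n (e * x))) \<le> w x"
    using crossings_dominated[OF ab] by blast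
  have "AE x in lebesgue. w x \<noteq> \<infinity>"
    using w by (intro nn_integral_PInf_AE) auto
  moreover have "AE x in lebesgue. e * x \<notin> V ` dyadic_points a b \<union> local_min_values V \<union>
      uminus ` local_min_values (\<lambda>u. - V u)"
    by (intro AE_level_notin countable_Un countable_image countable_dyadic_points countable_local_min_values)
  ultimately show ?thesis
  proof eventually_elim
    fix x assume wx: "w x \<noteq> \<infinity>"
      and x: "e * x \<notin> V ` dyadic_points a b \<union> local_min_values V
          \<union> uminus ` local_min_values (\<lambda>u. - V u)"
    obtain K where K: "w x = ennreal K" "0 \<le> K"
      using wx by (cases "w x") auto
    have "grid_variation (\<lambda>u. of_bool (V u < e * x)) a b n \<le> \<lfloor>K\<rfloor>" for n
    proof -
      have "ennreal (real (card (upcrossings V a b n (e * x)) + card (downcrossings V a b n (e * x)))) \<le> ennreal K"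
        using w(3)[of n x] by (simp only: K(1) ennreal_real_add)
      then have "real (card (upcrossings V a b n (e * x)) + card (downcrossings V a b n (e * x))) \<le> K"
        using K(2) by (simp only: ennreal_le_iff)
      moreover have "grid_variation (\<lambda>u. of_bool (V u < e * x)) a b n =
          int (card (upcrossings V a b n (e * x)) + card (downcrossings V a b n (e * x)))"
        using card_crossings[OF ab(2), of "e * x" V n] x by simp
      ultimately show ?thesis
        by (simp only: le_floor_iff of_int_of_nat_eq)
    qed
    moreover have "- (e * x) \<notin> local_min_values (\<lambda>u. - V u)"
      using x by (auto simp: image_iff)
    ultimately show "finite (up_times V (e * x) \<inter> {a<..b}) \<and>
      (\<forall>\<^sub>F n in sequentially. card (upcrossings V a b n (e * x)) = card (up_times V (e * x) \<inter> {a<..b}))"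
      using upcrossings_eventually_eq[OF ab, of "e * x"] x by blast
  qed
qed

text \<open>Almost everywhere the upcrossing counts eventually equal the number of up times, so
  dominated convergence applies. Measurability comes from the limes inferior of the counts.\<close>

lemma up_times_integral:
  assumes ab: "0 \<le> a" "a < b"
  shows "(\<lambda>x. ecard (up_times V (e * x) \<inter> {a<..b})) \<in> borel_measurable lebesgue" (is ?meas)
    and "(\<lambda>n. ennreal (pos_sum V a b n)) \<longlonglongrightarrow> (\<integral>\<^sup>+x. ecard (up_times V (e * x) \<inter> {a<..b}) \<partial>lebesgue)"
proof -
  define u where "u n x = (of_nat (card (upcrossings V a b n (e * x))) :: ennreal)" for n x
  have [measurable]: "u n \<in> borel_measurable lebesgue" for n
    unfolding u_def by (rule upcrossings_integral)
  have lim: "AE x in lebesgue. (\<lambda>n. u n x) \<longlonglongrightarrow> ecard (up_times V (e * x) \<inter> {a<..b})"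
    using AE_upcrossings_eq[OF ab]
  proof eventually_elim
    fix x assume *: "finite (up_times V (e * x) \<inter> {a<..b}) \<and>
      (\<forall>\<^sub>F n in sequentially. card (upcrossings V a b n (e * x)) = card (up_times V (e * x) \<inter> {a<..b}))"
    then have "\<forall>\<^sub>F n in sequentially. u n x = ecard (up_times V (e * x) \<inter> {a<..b})"
      by (auto simp: u_def elim: eventually_mono)
    then show "(\<lambda>n. u n x) \<longlonglongrightarrow> ecard (up_times V (e * x) \<inter> {a<..b})"
      by (rule tendsto_eventually)
  qed
  have "(\<lambda>x. liminf (\<lambda>n. u n x)) \<in> borel_measurable lebesgue"
    by measurable
  moreover have "AE x in lebesgue. liminf (\<lambda>n. u n x) = ecard (up_times V (e * x) \<inter> {a<..b})"
    using lim by eventually_elim (rule lim_imp_Liminf, simp_all)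
  ultimately show ?meas
    by (rule borel_measurable_completion_AE)
  obtain w where w: "w \<in> borel_measurable lebesgue" "(\<integral>\<^sup>+x. w x \<partial>lebesgue) < \<infinity>"
    "\<And>x n. of_nat (card (upcrossings V a b n (e * x))) + of_nat (card (downcrossings V a b n (e * x))) \<le> w x"
    using crossings_dominated[OF ab] by blast
  have "u n x \<le> w x" for n x
    unfolding u_def by (rule order_trans[OF _ w(3)[of n x]]) simp
  then have "(\<lambda>n. \<integral>\<^sup>+x. u n x \<partial>lebesgue)
      \<longlonglongrightarrow> (\<integral>\<^sup>+x. ecard (up_times V (e * x) \<inter> {a<..b}) \<partial>lebesgue)"
    using w \<open>?meas\<close> lim by (intro nn_integral_dominated_convergence[where w=w]) auto
  then show "(\<lambda>n. ennreal (pos_sum V a b n))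
      \<longlonglongrightarrow> (\<integral>\<^sup>+x. ecard (up_times V (e * x) \<inter> {a<..b}) \<partial>lebesgue)"
    by (simp add: u_def upcrossings_integral(2))
qed

text \<open>For almost every level, up times split into increasing crossings and upward jumps, and
  the latter integrate to the sum of the positive jumps. Subtracting them leaves the
  crossings.\<close>

lemma incr_integral:
  assumes ab: "0 \<le> a" "a < b"
  shows "(\<lambda>x. ecard ({s. incr_through V (e * x) s} \<inter> {a<..b})) \<in> borel_measurable lebesgue" (is ?meas)
    and "\<exists>p\<ge>0. (\<integral>\<^sup>+x. ecard ({s. incr_through V (e * x) s} \<inter> {a<..b}) \<partial>lebesgue) = ennreal p \<and>
      pos_sum V a b \<longlonglongrightarrow> p + (\<Sum>\<^sub>\<infinity>s\<in>{a<..b}. max 0 (jump V s))"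
proof -
  let ?I = "\<lambda>x. ecard ({s. incr_through V (e * x) s} \<inter> {a<..b})"
  let ?U = "\<lambda>x. ecard (up_times V (e * x) \<inter> {a<..b})"
  let ?J = "\<lambda>x. ecard (up_jumps (e * x) \<inter> {a<..b})"
  let ?j = "\<Sum>\<^sub>\<infinity>s\<in>{a<..b}. max 0 (jump V s)"
  note [measurable] = up_times_integral(1)[OF ab] up_jumps_integral(1)[OF ab(1)]
  let ?D = "{s \<in> {a<..b}. jump V s \<noteq> 0}"
  have "AE x in lebesgue. e * x \<notin> V ` ?D \<union> left_lim V ` ?D"
    using ab by (intro AE_level_notin countable_Un countable_image countable_jumps)
  then have add: "AE x in lebesgue. ?U x = ?I x + ?J x"
    by eventually_elim (rule ecard_up_times[OF ab(1)], simp_all only: Un_iff de_Morgan_disj simp_thms)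
  have "AE x in lebesgue. ?U x - ?J x = ?I x"
    using add AE_upcrossings_eq[OF ab]
  proof eventually_elim
    fix x assume *: "?U x = ?I x + ?J x" and "finite (up_times V (e * x) \<inter> {a<..b}) \<and>
      (\<forall>\<^sub>F n in sequentially. card (upcrossings V a b n (e * x)) = card (up_times V (e * x) \<inter> {a<..b}))"
    then have "?U x \<noteq> top"
      unfolding ecard_eq_top_iff by simp
    then have "?J x \<noteq> top"
      by (simp only: * ennreal_add_eq_top de_Morgan_disj simp_thms)
    then show "?U x - ?J x = ?I x"
      unfolding * by (rule ennreal_add_diff_cancel_right)
  qed
  moreover have "(\<lambda>x. ?U x - ?J x) \<in> borel_measurable lebesgue"
    by measurable
  ultimately show I: ?meas
    by (rule borel_measurable_completion_AE[rotated])
  have "(\<integral>\<^sup>+x. ?U x \<partial>lebesgue) = (\<integral>\<^sup>+x. ?I x + ?J x \<partial>lebesgue)"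
    by (rule nn_integral_cong_AE[OF add])
  also have "\<dots> = (\<integral>\<^sup>+x. ?I x \<partial>lebesgue) + ennreal ?j"
    using I by (subst nn_integral_add) (auto simp: up_jumps_integral[OF ab(1)])
  finally have eq: "(\<integral>\<^sup>+x. ?U x \<partial>lebesgue) = (\<integral>\<^sup>+x. ?I x \<partial>lebesgue)
      + ennreal ?j" .
  \<comment> \<open>The variation bound makes the integrals finite, so that the limit can be stated
    with a real \<open>p\<close>.\<close>
  have "pos_sum V a b n \<le> variation V 0 b" for n
    using grid_sum_le_variation[OF bv, of b a b n] ab pos_sum_add[of V a b n] pos_sum_nonneg[of "\<lambda>s. - V s" a b n]
    by auto
  then have "(\<integral>\<^sup>+x. ?U x \<partial>lebesgue) \<le> ennreal (variation V 0 b)"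
    by (intro tendsto_upperbound[OF up_times_integral(2)[OF ab]]) (auto intro!: always_eventually ennreal_leI)
  then have "(\<integral>\<^sup>+x. ?I x \<partial>lebesgue) \<noteq> top"
    using eq by (auto simp: top_unique)
  then obtain p where p: "(\<integral>\<^sup>+x. ?I x \<partial>lebesgue) = ennreal p" "p \<ge> 0"
    by (cases "\<integral>\<^sup>+x. ?I x \<partial>lebesgue") auto
  have j: "0 \<le> ?j"
    by (rule infsum_nonneg) simp
  have "(\<lambda>n. ennreal (pos_sum V a b n)) \<longlonglongrightarrow> ennreal (p + ?j)"
    using up_times_integral(2)[OF ab] p j by (simp add: eq)
  then have "pos_sum V a b \<longlonglongrightarrow> p + ?j"
    using p j by (subst (asm) tendsto_ennreal_iff) (auto simp: pos_sum_nonneg)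
  with p show "\<exists>p\<ge>0. (\<integral>\<^sup>+x. ?I x \<partial>lebesgue) = ennreal p \<and> pos_sum V a b
      \<longlonglongrightarrow> p + ?j"
    by blast
qed

end

subsection \<open>Variation of the continuous part\<close>

text \<open>The sign is 1 for \<open>V\<close>. The reflected path gets the sign -1, and its
  increase through level \<open>- x\<close> is by definition the decrease of \<open>V\<close>
  through \<open>x\<close>.\<close>

locale occupation_path = bv_path V 1 for V

sublocale occupation_path \<subseteq> neg: bv_path "\<lambda>s. - V s" "- 1"
  using bv_path_uminus by simp

context occupation_path
begin

text \<open>For \<open>0 \<le> a \<le> b\<close> this turns out to be the increment over
  \<open>(a, b]\<close> of the positive variation of the continuous part, and
  \<open>down_mass\<close> that of the negative variation.\<close>

definition up_mass :: "real \<Rightarrow> real \<Rightarrow> real" where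
  "up_mass a b = enn2real (\<integral>\<^sup>+x. ecard ({s. incr_through V x s} \<inter> {a<..b}) \<partial>lebesgue)"

definition down_mass :: "real \<Rightarrow> real \<Rightarrow> real" where
  "down_mass a b = enn2real (\<integral>\<^sup>+x. ecard ({s. decr_through V x s} \<inter> {a<..b}) \<partial>lebesgue)"

lemma up_mass:
  assumes "0 \<le> a" "a \<le> b"
  shows "(\<lambda>x. ecard ({s. incr_through V x s} \<inter> {a<..b})) \<in> borel_measurable lebesgue"
    and "(\<integral>\<^sup>+x. ecard ({s. incr_through V x s} \<inter> {a<..b}) \<partial>lebesgue) = ennreal (up_mass a b)"
    and "a < b \<Longrightarrow> pos_sum V a b \<longlonglongrightarrow> up_mass a b
        + (\<Sum>\<^sub>\<infinity>s\<in>{a<..b}. max 0 (jump V s))"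
proof -
  have "a = b \<or> a < b" using assms by auto
  then have *: "(\<lambda>x. ecard ({s. incr_through V x s} \<inter> {a<..b})) \<in> borel_measurable lebesgue \<and>
    (\<integral>\<^sup>+x. ecard ({s. incr_through V x s} \<inter> {a<..b}) \<partial>lebesgue)
        = ennreal (up_mass a b) \<and>
    (a < b \<longrightarrow> pos_sum V a b \<longlonglongrightarrow> up_mass a b
        + (\<Sum>\<^sub>\<infinity>s\<in>{a<..b}. max 0 (jump V s)))"
  proof
    assume "a < b"
    from incr_integral(2)[OF assms(1) this] obtain p where p: "p \<ge> 0"
      "(\<integral>\<^sup>+x. ecard ({s. incr_through V x s} \<inter> {a<..b}) \<partial>lebesgue) = ennreal p"
      "pos_sum V a b \<longlonglongrightarrow> p + (\<Sum>\<^sub>\<infinity>s\<in>{a<..b}. max 0 (jump V s))"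
      by auto
    moreover have "up_mass a b = p"
      using p(1,2) by (simp add: up_mass_def)
    ultimately show ?thesis
      using incr_integral(1)[OF assms(1) \<open>a < b\<close>] by simp
  qed (simp add: up_mass_def)
  from * show "(\<lambda>x. ecard ({s. incr_through V x s} \<inter> {a<..b})) \<in> borel_measurable lebesgue"
    and "(\<integral>\<^sup>+x. ecard ({s. incr_through V x s} \<inter> {a<..b}) \<partial>lebesgue) = ennreal (up_mass a b)"
    and "a < b \<Longrightarrow> pos_sum V a b \<longlonglongrightarrow> up_mass a b
        + (\<Sum>\<^sub>\<infinity>s\<in>{a<..b}. max 0 (jump V s))"
    by blast+
qed

lemma down_mass:
  assumes "0 \<le> a" "a \<le> b"
  shows "(\<lambda>x. ecard ({s. decr_through V x s} \<inter> {a<..b})) \<in> borel_measurable lebesgue"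
    and "(\<integral>\<^sup>+x. ecard ({s. decr_through V x s} \<inter> {a<..b}) \<partial>lebesgue)
        = ennreal (down_mass a b)"
    and "a < b \<Longrightarrow> pos_sum (\<lambda>s. - V s) a b \<longlonglongrightarrow> down_mass a b
        + (\<Sum>\<^sub>\<infinity>s\<in>{a<..b}. max 0 (- jump V s))"
proof -
  have J: "(\<Sum>\<^sub>\<infinity>s\<in>{a<..b}. max 0 (jump (\<lambda>s. - V s) s))
      = (\<Sum>\<^sub>\<infinity>s\<in>{a<..b}. max 0 (- jump V s))"
    using assms(1) by (intro infsum_cong) (simp add: jump_uminus)
  have "a = b \<or> a < b" using assms by auto
  then have *: "(\<lambda>x. ecard ({s. decr_through V x s} \<inter> {a<..b})) \<in> borel_measurable lebesgue \<and>
    (\<integral>\<^sup>+x. ecard ({s. decr_through V x s} \<inter> {a<..b}) \<partial>lebesgue)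
        = ennreal (down_mass a b) \<and>
    (a < b \<longrightarrow> pos_sum (\<lambda>s. - V s) a b \<longlonglongrightarrow> down_mass a b
        + (\<Sum>\<^sub>\<infinity>s\<in>{a<..b}. max 0 (- jump V s)))"
  proof
    assume "a < b"
    from neg.incr_integral(2)[OF assms(1) this] obtain p where p: "p \<ge> 0"
      "(\<integral>\<^sup>+x. ecard ({s. decr_through V x s} \<inter> {a<..b}) \<partial>lebesgue) = ennreal p"
      "pos_sum (\<lambda>s. - V s) a b \<longlonglongrightarrow> p
          + (\<Sum>\<^sub>\<infinity>s\<in>{a<..b}. max 0 (- jump V s))"
      by (auto simp: decr_through_def J)
    moreover have "down_mass a b = p"
      using p(1,2) by (simp add: down_mass_def)
    ultimately show ?thesis
      using neg.incr_integral(1)[OF assms(1) \<open>a < b\<close>] by (simp add: decr_through_def)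
  qed (simp add: down_mass_def)
  from * show "(\<lambda>x. ecard ({s. decr_through V x s} \<inter> {a<..b})) \<in> borel_measurable lebesgue"
    and "(\<integral>\<^sup>+x. ecard ({s. decr_through V x s} \<inter> {a<..b}) \<partial>lebesgue)
        = ennreal (down_mass a b)"
    and "a < b \<Longrightarrow> pos_sum (\<lambda>s. - V s) a b \<longlonglongrightarrow> down_mass a b
        + (\<Sum>\<^sub>\<infinity>s\<in>{a<..b}. max 0 (- jump V s))"
    by blast+
qed

lemma mass_nonneg: "0 \<le> up_mass a b" "0 \<le> down_mass a b"
  by (simp_all add: up_mass_def down_mass_def)

lemma mass_empty: "up_mass a a = 0" "down_mass a a = 0"
  by (simp_all add: up_mass_def down_mass_def)

lemma up_mass_split:
  assumes "0 \<le> a" "a \<le> b" "b \<le> c"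
  shows "up_mass a c = up_mass a b + up_mass b c"
proof -
  have "ennreal (up_mass a c) = ennreal (up_mass a b) + ennreal (up_mass b c)"
    using assms up_mass[of a c] up_mass[of a b] up_mass[of b c]
    by (simp add: ecard_Ioc_split[OF assms(2,3)] nn_integral_add)
  then show ?thesis
    by (simp add: mass_nonneg flip: ennreal_plus)
qed

lemma down_mass_split:
  assumes "0 \<le> a" "a \<le> b" "b \<le> c"
  shows "down_mass a c = down_mass a b + down_mass b c"
proof -
  have "ennreal (down_mass a c) = ennreal (down_mass a b) + ennreal (down_mass b c)"
    using assms down_mass[of a c] down_mass[of a b] down_mass[of b c]
    by (simp add: ecard_Ioc_split[OF assms(2,3)] nn_integral_add)
  then show ?thesis
    by (simp add: mass_nonneg flip: ennreal_plus)
qed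

lemma neg_jump_summable: "0 \<le> a \<Longrightarrow> (\<lambda>s. max 0 (- jump V s)) summable_on {a<..b}"
  by (rule summable_on_comparison_test[OF jump_abs_summable]) auto

lemma disc_part_diff:
  assumes "0 \<le> a" "a \<le> b"
  shows "disc_part V b - disc_part V a = (\<Sum>\<^sub>\<infinity>s\<in>{a<..b}. jump V s)"
proof -
  have "{0<..b} = {0<..a} \<union> {a<..b}" using assms by auto
  then show ?thesis
    unfolding disc_part_def using assms
    by (simp add: infsum_Un_disjoint jump_summable ivl_disj_int)
qed

lemma infsum_jump_split:
  assumes "0 \<le> a"
  shows "(\<Sum>\<^sub>\<infinity>s\<in>{a<..b}. max 0 (jump V s))
      = (\<Sum>\<^sub>\<infinity>s\<in>{a<..b}. jump V s) + (\<Sum>\<^sub>\<infinity>s\<in>{a<..b}. max 0 (- jump V s))"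
    and "(\<Sum>\<^sub>\<infinity>s\<in>{a<..b}. \<bar>jump V s\<bar>)
        = (\<Sum>\<^sub>\<infinity>s\<in>{a<..b}. max 0 (jump V s))
            + (\<Sum>\<^sub>\<infinity>s\<in>{a<..b}. max 0 (- jump V s))"
  by (subst infsum_add[symmetric];
      use assms in \<open>auto intro!: infsum_cong jump_summable neg_jump_summable pos_jump_summable\<close>)+

text \<open>In the limit, the positive minus the negative increments of \<open>V\<close> amount to
  the difference of the masses plus the sum of all jumps, which is the increment of
  \<open>disc_part V\<close>.\<close>

lemma cont_part_diff:
  assumes "0 \<le> a" "a \<le> b"
  shows "cont_part V b - cont_part V a = up_mass a b - down_mass a b"
proof (cases "a < b")
  case True
  have "(\<lambda>n. pos_sum V a b n - pos_sum (\<lambda>s. - V s) a b n) \<longlonglongrightarrow>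
      (up_mass a b + (\<Sum>\<^sub>\<infinity>s\<in>{a<..b}. max 0 (jump V s))) - (down_mass a b
          + (\<Sum>\<^sub>\<infinity>s\<in>{a<..b}. max 0 (- jump V s)))"
    by (intro tendsto_diff up_mass(3) down_mass(3) assms True)
  then have "V b - V a = (up_mass a b + (\<Sum>\<^sub>\<infinity>s\<in>{a<..b}. max 0 (jump V s))) - (down_mass a b
      + (\<Sum>\<^sub>\<infinity>s\<in>{a<..b}. max 0 (- jump V s)))"
    unfolding pos_sum_diff by (rule LIMSEQ_unique[OF tendsto_const])
  then show ?thesis
    using infsum_jump_split(1)[OF assms(1), of b] disc_part_diff[OF assms] by (simp add: cont_part_def)
next
  case False
  then show ?thesis using assms by (simp add: mass_empty)
qed

text \<open>An increment of the continuous part is a difference of two masses, hence bounded by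
  their sum, which is additive over intervals and telescopes.\<close>

lemma partition_sum_cont_part_le:
  assumes "sorted xs" "set xs \<subseteq> {0..b}"
  shows "partition_sum (cont_part V) xs \<le> up_mass 0 b + down_mass 0 b"
proof (cases "xs = []")
  case True
  then show ?thesis by (simp add: partition_sum_def mass_nonneg)
next
  case False
  let ?G = "\<lambda>i. up_mass 0 (xs ! i) + down_mass 0 (xs ! i)"
  let ?m = "length xs - 1"
  have mem: "0 \<le> xs ! i" "xs ! i \<le> b" if "i < length xs" for i
    using subsetD[OF assms(2) nth_mem[OF that]] by auto
  have "partition_sum (cont_part V) xs \<le> (\<Sum>i<?m. ?G (Suc i) - ?G i)"
    unfolding partition_sum_def
  proof (rule sum_mono)
    fix i assume "i \<in> {..<?m}"
    then have i: "Suc i < length xs" by auto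
    have le: "0 \<le> xs ! i" "xs ! i \<le> xs ! Suc i"
      using mem[of i] i assms(1) by (auto simp: sorted_iff_nth_Suc)
    have "\<bar>cont_part V (xs ! Suc i) - cont_part V (xs ! i)\<bar> \<le> up_mass (xs ! i) (xs ! Suc i)
        + down_mass (xs ! i) (xs ! Suc i)"
      using mass_nonneg[of "xs ! i" "xs ! Suc i"] by (simp add: cont_part_diff[OF le])
    also have "\<dots> = ?G (Suc i) - ?G i"
      using up_mass_split[of 0 "xs ! i" "xs ! Suc i"] down_mass_split[of 0 "xs ! i" "xs ! Suc i"] le by simp
    finally show "\<bar>cont_part V (xs ! Suc i) - cont_part V (xs ! i)\<bar> \<le> ?G (Suc i) - ?G i" .
  qed
  also have "\<dots> = ?G ?m - ?G 0"
    using sum_lessThan_telescope[of ?G ?m] by simp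
  also have "\<dots> \<le> ?G ?m"
    using mass_nonneg[of 0 "xs ! 0"] by simp
  also have "\<dots> \<le> up_mass 0 b + down_mass 0 b"
    using mem[of ?m] False up_mass_split[of 0 "xs ! ?m" b] down_mass_split[of 0 "xs ! ?m" b]
      mass_nonneg[of "xs ! ?m" b] by simp
  finally show ?thesis .
qed

lemma bounded_variation_cont_part: "bounded_variation_on (cont_part V) 0 b"
  unfolding bounded_variation_on_def partition_sums_def
  by (rule bdd_aboveI2[where M="up_mass 0 b + down_mass 0 b"]) (auto intro: partition_sum_cont_part_le)

text \<open>The increments of \<open>J\<close>, the accumulated absolute jumps, dominate those of
  \<open>disc_part V\<close> and telescope.\<close>

lemma grid_sum_disc_part_le:
  assumes b: "0 < b"
  shows "(\<Sum>k<2 ^ n. \<bar>disc_part V (grid 0 b n (Suc k)) - disc_part V (grid 0 b n k)\<bar>)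
      \<le> (\<Sum>\<^sub>\<infinity>s\<in>{0<..b}. \<bar>jump V s\<bar>)"
proof -
  define J where "J s = (\<Sum>\<^sub>\<infinity>r\<in>{0<..s}. \<bar>jump V r\<bar>)" for s
  have "\<bar>disc_part V (grid 0 b n (Suc k)) - disc_part V (grid 0 b n k)\<bar> \<le> J (grid 0 b n (Suc k))
      - J (grid 0 b n k)" for k
  proof -
    let ?a = "grid 0 b n k" and ?c = "grid 0 b n (Suc k)"
    have ac: "0 \<le> ?a" "?a \<le> ?c"
      using b grid_ge[of 0 b n k] by (auto simp: grid_le_iff)
    then have "{0<..?c} = {0<..?a} \<union> {?a<..?c}" by auto
    then have "J ?c = J ?a + (\<Sum>\<^sub>\<infinity>r\<in>{?a<..?c}. \<bar>jump V r\<bar>)"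
      unfolding J_def using ac by (simp add: infsum_Un_disjoint jump_abs_summable ivl_disj_int)
    moreover have "\<bar>\<Sum>\<^sub>\<infinity>r\<in>{?a<..?c}. jump V r\<bar>
        \<le> (\<Sum>\<^sub>\<infinity>r\<in>{?a<..?c}. \<bar>jump V r\<bar>)"
      using norm_infsum_bound[of "jump V" "{?a<..?c}"] jump_abs_summable[OF ac(1), of ?c] by simp
    ultimately show ?thesis
      by (simp add: disc_part_diff[OF ac])
  qed
  then have "(\<Sum>k<2 ^ n. \<bar>disc_part V (grid 0 b n (Suc k)) - disc_part V (grid 0 b n k)\<bar>) \<le>
      (\<Sum>k<2 ^ n. J (grid 0 b n (Suc k)) - J (grid 0 b n k))"
    by (intro sum_mono)
  also have "\<dots> = J b"
    using sum_lessThan_telescope[of "\<lambda>k. J (grid 0 b n k)" "2 ^ n"] by (simp add: J_def)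
  finally show ?thesis by (simp add: J_def)
qed

text \<open>For the lower bound, \<open>V\<close> varies along the grid at most as much as its
  continuous and discontinuous parts together. In the limit the left side is the two masses plus the
  sum of the absolute jumps; that sum also bounds the discontinuous part and cancels.\<close>

lemma variation_cont_part:
  assumes b: "0 \<le> b"
  shows "variation (cont_part V) 0 b = up_mass 0 b + down_mass 0 b"
proof (rule antisym)
  have ne: "partition_sum (cont_part V) [] \<in> partition_sums (cont_part V) 0 b"
    unfolding partition_sums_def by (rule imageI) simp
  show "variation (cont_part V) 0 b \<le> up_mass 0 b + down_mass 0 b"
    unfolding variation_def
  proof (rule cSup_least)
    show "partition_sums (cont_part V) 0 b \<noteq> {}"
      using ne by blast
  qed (auto simp: partition_sums_def intro: partition_sum_cont_part_le)
  show "up_mass 0 b + down_mass 0 b \<le> variation (cont_part V) 0 b"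
  \<comment> \<open>The limits along grids concern nondegenerate intervals. For \<open>b = 0\<close>
    the masses vanish and the empty partition shows that the variation is nonnegative.\<close>
  proof (cases "b = 0")
    case True
    have "partition_sum (cont_part V) [] \<le> variation (cont_part V) 0 b"
      unfolding variation_def using bounded_variation_cont_part[of b] ne
      by (intro cSup_upper) (auto simp: bounded_variation_on_def)
    then show ?thesis
      using True by (simp add: mass_empty partition_sum_def)
  next
    case False
    then have b: "0 < b" using assms by simp
    let ?J = "\<Sum>\<^sub>\<infinity>s\<in>{0<..b}. \<bar>jump V s\<bar>"
    have lim: "(\<lambda>n. pos_sum V 0 b n + pos_sum (\<lambda>s. - V s) 0 b n) \<longlonglongrightarrow>
      (up_mass 0 b + (\<Sum>\<^sub>\<infinity>s\<in>{0<..b}. max 0 (jump V s))) + (down_mass 0 b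
          + (\<Sum>\<^sub>\<infinity>s\<in>{0<..b}. max 0 (- jump V s)))"
      using b by (intro tendsto_add up_mass(3) down_mass(3)) auto
    have le: "pos_sum V 0 b n + pos_sum (\<lambda>s. - V s) 0 b n \<le> variation (cont_part V) 0 b + ?J" for n
    proof -
      have "pos_sum V 0 b n + pos_sum (\<lambda>s. - V s) 0 b n \<le>
          (\<Sum>k<2 ^ n. \<bar>cont_part V (grid 0 b n (Suc k)) - cont_part V (grid 0 b n k)\<bar>) +
          (\<Sum>k<2 ^ n. \<bar>disc_part V (grid 0 b n (Suc k)) - disc_part V (grid 0 b n k)\<bar>)"
        unfolding pos_sum_add sum.distrib[symmetric] by (intro sum_mono) (simp add: cont_part_def)
      also have "\<dots> \<le> variation (cont_part V) 0 b + ?J"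
        using b by (intro add_mono grid_sum_disc_part_le grid_sum_le_variation bounded_variation_cont_part) auto
      finally show ?thesis .
    qed
    have "(up_mass 0 b + (\<Sum>\<^sub>\<infinity>s\<in>{0<..b}. max 0 (jump V s))) + (down_mass 0 b
        + (\<Sum>\<^sub>\<infinity>s\<in>{0<..b}. max 0 (- jump V s)))
       \<le> variation (cont_part V) 0 b + ?J"
      by (rule LIMSEQ_le_const2[OF lim]) (use le in blast)
    then show ?thesis
      using infsum_jump_split(2)[of 0 b] by simp
  qed
qed

section \<open>Jordan decomposition of the continuous part\<close>

lemma tv_cont_diff:
  assumes "a \<le> b"
  shows "tv_cont V b - tv_cont V a = up_mass (max 0 a) (max 0 b) + down_mass (max 0 a) (max 0 b)"
proof -
  have "max 0 a \<le> max 0 b" using assms by linarith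
  then show ?thesis
    using up_mass_split[of 0 "max 0 a" "max 0 b"] down_mass_split[of 0 "max 0 a" "max 0 b"]
    by (simp add: tv_cont_def variation_cont_part)
qed

text \<open>The increments of the total variation and of the continuous part are the sum and the
  difference of the masses; adding or subtracting and halving isolates each mass. Clipping at 0
  matches the constant extension to negative times.\<close>

lemma var_diff:
  assumes "a \<le> b"
  shows "pos_var V b - pos_var V a = up_mass (max 0 a) (max 0 b)"
    and "neg_var V b - neg_var V a = down_mass (max 0 a) (max 0 b)"
proof -
  have "max 0 a \<le> max 0 b" using assms by linarith
  then have "cont_part V (max 0 b) - cont_part V (max 0 a) = up_mass (max 0 a) (max 0 b) - down_mass (max 0 a) (max 0 b)"
    by (intro cont_part_diff) auto
  then show "pos_var V b - pos_var V a = up_mass (max 0 a) (max 0 b)"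
    and "neg_var V b - neg_var V a = down_mass (max 0 a) (max 0 b)"
    using tv_cont_diff[OF assms] by (auto simp: pos_var_def neg_var_def field_simps)
qed

text \<open>Crossing times are positive, so clipping the interval at 0 loses none of them.\<close>

lemma incr_Ioc: "{s. incr_through V x s} \<inter> {a<..b} = {s. incr_through V x s} \<inter> {max 0 a<..max 0 b}"
  by (auto simp: incr_through_def)

lemma decr_Ioc: "{s. decr_through V x s} \<inter> {a<..b} = {s. decr_through V x s} \<inter> {max 0 a<..max 0 b}"
  by (auto simp: decr_through_def incr_through_def)

sublocale incr: counting_kernel "\<lambda>x. {s. incr_through V x s}" "pos_var V"
proof
  fix a b :: real assume ab: "a \<le> b"
  show "pos_var V a \<le> pos_var V b"
    using var_diff(1)[OF ab] mass_nonneg(1)[of "max 0 a" "max 0 b"] by linarith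
  show "(\<lambda>x. ecard ({s. incr_through V x s} \<inter> {a<..b})) \<in> borel_measurable lebesgue"
    unfolding incr_Ioc[of _ a b] using ab by (intro up_mass) auto
  show "(\<integral>\<^sup>+x. ecard ({s. incr_through V x s} \<inter> {a<..b}) \<partial>lebesgue)
      = ennreal (pos_var V b - pos_var V a)"
    unfolding incr_Ioc[of _ a b] var_diff(1)[OF ab] using ab by (intro up_mass) auto
qed

sublocale decr: counting_kernel "\<lambda>x. {s. decr_through V x s}" "neg_var V"
proof
  fix a b :: real assume ab: "a \<le> b"
  show "neg_var V a \<le> neg_var V b"
    using var_diff(2)[OF ab] mass_nonneg(2)[of "max 0 a" "max 0 b"] by linarith
  show "(\<lambda>x. ecard ({s. decr_through V x s} \<inter> {a<..b})) \<in> borel_measurable lebesgue"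
    unfolding decr_Ioc[of _ a b] using ab by (intro down_mass) auto
  show "(\<integral>\<^sup>+x. ecard ({s. decr_through V x s} \<inter> {a<..b}) \<partial>lebesgue)
      = ennreal (neg_var V b - neg_var V a)"
    unfolding decr_Ioc[of _ a b] var_diff(2)[OF ab] using ab by (intro down_mass) auto
qed

text \<open>Just after \<open>s\<close> the path would be both above and below
  \<open>V s\<close>.\<close>

lemma not_incr_and_decr: "incr_through V x s \<Longrightarrow> \<not> decr_through V y s"
proof
  assume "incr_through V x s" "decr_through V y s"
  then obtain \<delta> \<delta>' where *: "\<delta> > 0" "\<delta>' > 0" "0 < s"
    "\<And>u. u \<ge> 0 \<Longrightarrow> 0 < \<bar>u - s\<bar> \<Longrightarrow> \<bar>u - s\<bar> < \<delta>
        \<Longrightarrow> sgn (V u - V s) = sgn (u - s)"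
    "\<And>u. u \<ge> 0 \<Longrightarrow> 0 < \<bar>u - s\<bar> \<Longrightarrow> \<bar>u - s\<bar> < \<delta>'
        \<Longrightarrow> sgn (- V u - - V s) = sgn (u - s)"
    unfolding incr_through_def decr_through_def by blast
  let ?u = "s + min \<delta> \<delta>' / 2"
  have "sgn (V ?u - V s) = 1" "sgn (- V ?u - - V s) = 1"
    using *(4)[of ?u] *(5)[of ?u] *(1-3) by auto
  then show False
    by (simp add: sgn_if split: if_splits)
qed

text \<open>The total variation function is the sum of \<open>pos_var V\<close> and
  \<open>neg_var V\<close>, and counts add over disjoint sets. This instance serves
  \<open>vartheta\<close>, which is defined by the measure of \<open>tv_cont V\<close>
  itself.\<close>

sublocale both: counting_kernel "\<lambda>x. {s. incr_through V x s} \<union> {s. decr_through V x s}" "tv_cont V"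
proof
  fix a b :: real assume ab: "a \<le> b"
  have tv: "tv_cont V b - tv_cont V a = (pos_var V b - pos_var V a) + (neg_var V b - neg_var V a)"
    by (simp add: pos_var_def neg_var_def field_simps)
  show "tv_cont V a \<le> tv_cont V b"
    using tv incr.mono[OF ab] decr.mono[OF ab] by linarith
  have eq: "ecard (({s. incr_through V x s} \<union> {s. decr_through V x s}) \<inter> {a<..b}) =
      ecard ({s. incr_through V x s} \<inter> {a<..b}) + ecard ({s. decr_through V x s} \<inter> {a<..b})" for x
    unfolding Int_Un_distrib2 by (rule ecard_Un) (use not_incr_and_decr in blast)
  show "(\<lambda>x. ecard (({s. incr_through V x s}
      \<union> {s. decr_through V x s}) \<inter> {a<..b})) \<in> borel_measurable lebesgue"
    unfolding eq by (intro borel_measurable_add incr.meas decr.meas ab)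
  show "(\<integral>\<^sup>+x. ecard (({s. incr_through V x s}
      \<union> {s. decr_through V x s}) \<inter> {a<..b}) \<partial>lebesgue) =
      ennreal (tv_cont V b - tv_cont V a)"
    unfolding eq tv using incr.meas[OF ab] decr.meas[OF ab] incr.mono[OF ab] decr.mono[OF ab]
    by (simp add: nn_integral_add incr.int[OF ab] decr.int[OF ab])
qed

text \<open>Away from the countably many jump times \<open>V\<close> is continuous, and every set of
  jump times is countable, hence Borel.\<close>

lemma occ_set_borel:
  assumes A: "A \<in> sets borel"
  shows "occ_set V t A \<in> sets borel"
proof -
  let ?D = "{s \<in> {0<..t}. jump V s \<noteq> 0}"
  let ?C = "{0<..t} - ?D"
  have D: "countable ?D"
    by (rule countable_jumps) simp
  have sub_D: "S \<in> sets borel" if "S \<subseteq> ?D" for S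
    using countable_subset[OF that D] by (rule sets.countable[rotated]) auto
  have C: "?C \<in> sets borel"
    by (rule sets.Diff[OF _ sub_D[OF order_refl]]) simp
  have "continuous_on ?C V"
    by (intro continuous_at_imp_continuous_on ballI) (auto simp: isCont_iff_jump)
  then have "V \<in> borel_measurable (restrict_space borel ?C)"
    by (rule borel_measurable_continuous_on_restrict)
  then have "V -` A \<inter> space (restrict_space borel ?C) \<in> sets (restrict_space borel ?C)"
    using A by (rule measurable_sets)
  then have "V -` A \<inter> ?C \<in> sets borel"
    unfolding space_restrict_space space_borel Int_UNIV_right
    by (rule sets_restrict_space_iff[THEN iffD1, THEN conjunct2, rotated]) (use C in simp)
  moreover have "V -` A \<inter> ?D \<in> sets borel"
    by (rule sub_D) (rule Int_lower2)
  ultimately have "(V -` A \<inter> ?C) \<union> (V -` A \<inter> ?D) \<in> sets borel"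
    by (rule sets.Un)
  also have "(V -` A \<inter> ?C) \<union> (V -` A \<inter> ?D) = occ_set V t A"
    by (auto simp: occ_set_def)
  finally show ?thesis .
qed

end

section \<open>Densities of the occupation measures\<close>

theorem theorem1:
  fixes V :: "real \<Rightarrow> real" and t :: real
  assumes "cadlag V"
    and "\<And>T. T \<ge> 0 \<Longrightarrow> bounded_variation_on V 0 T"
    and "t > 0"
  shows "(AE x in lebesgue. finite (incr_times V t x) \<and> finite (decr_times V t x))
    \<and> (\<lambda>x. real_of_int (ell V t x)) \<in> borel_measurable lebesgue
    \<and> (\<lambda>x. real (lam V t x)) \<in> borel_measurable lebesgue
    \<and> integrable lebesgue (\<lambda>x. real_of_int (ell V t x))
    \<and> integrable lebesgue (\<lambda>x. real (lam V t x))
    \<and> (\<forall>A \<in> sets borel.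
         theta V t A = (LINT x:A|lebesgue. real_of_int (ell V t x))
       \<and> vartheta V t A = (LINT x:A|lebesgue. real (lam V t x)))"
proof -
  interpret occupation_path V
    by unfold_locales (use assms in auto)
  have t: "0 \<le> t" using assms by simp
  let ?I = "\<lambda>x. {s. incr_through V x s} \<inter> {0<..t}" and ?D
      = "\<lambda>x. {s. decr_through V x s} \<inter> {0<..t}"
  let ?B = "\<lambda>x. ({s. incr_through V x s} \<union> {s. decr_through V x s}) \<inter> {0<..t}"
  have times: "incr_times V t x = ?I x" "decr_times V t x = ?D x" for x
    by (auto simp: incr_times_def decr_times_def)
  have incr: "set_integrable lebesgue A (\<lambda>x. real (card (?I x)))"
      "(LINT x:A|lebesgue. real (card (?I x))) = measure (interval_measure (pos_var V)) (occ_set V t A)"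
    and decr: "set_integrable lebesgue A (\<lambda>x. real (card (?D x)))"
      "(LINT x:A|lebesgue. real (card (?D x))) = measure (interval_measure (neg_var V)) (occ_set V t A)"
    and both: "(LINT x:A|lebesgue. real (card (?B x))) = measure (interval_measure (tv_cont V)) (occ_set V t A)"
    if A: "A \<in> sets borel" for A
    by (rule incr.occupation_integral decr.occupation_integral both.occupation_integral;
        use t A occ_set_borel[OF A] in \<open>auto simp: incr_through_def decr_through_def\<close>)+
  have fin: "AE x in lebesgue. finite (?I x) \<and> finite (?D x)"
    using incr.AE_finite[OF t] decr.AE_finite[OF t] by eventually_elim simp
  \<comment> \<open>Taking all of \<open>UNIV\<close> as the set of levels gives integrability over
    the whole line.\<close>
  have intI: "integrable lebesgue (\<lambda>x. real (card (?I x)))"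
      and intD: "integrable lebesgue (\<lambda>x. real (card (?D x)))"
    using incr(1)[of UNIV] decr(1)[of UNIV] by (simp_all add: set_integrable_def)
  have ell: "real_of_int (ell V t x) = real (card (?I x)) - real (card (?D x))"
    and lam: "real (lam V t x) = real (card (?I x)) + real (card (?D x))" for x
    by (simp_all add: ell_def lam_def times)
  have int_ell: "integrable lebesgue (\<lambda>x. real_of_int (ell V t x))"
    unfolding ell by (rule Bochner_Integration.integrable_diff[OF intI intD])
  have int_lam: "integrable lebesgue (\<lambda>x. real (lam V t x))"
    unfolding lam by (rule Bochner_Integration.integrable_add[OF intI intD])
  have theta: "theta V t A = (LINT x:A|lebesgue. real_of_int (ell V t x))" if A: "A \<in> sets borel" for A
    unfolding theta_def ell using set_integral_diff(2)[OF incr(1)[OF A] decr(1)[OF A]]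
    by (simp add: incr(2)[OF A] decr(2)[OF A])
  \<comment> \<open>If just one of the two sets is infinite, the union has \<open>card\<close> 0
    while \<open>lam\<close> may be positive; hence equality is claimed only almost
    everywhere.\<close>
  have card_B: "AE x in lebesgue. real (card (?B x)) = real (lam V t x)"
    using fin
  proof eventually_elim
    fix x assume "finite (?I x) \<and> finite (?D x)"
    then have "card (?I x \<union> ?D x) = card (?I x) + card (?D x)"
      by (intro card_Un_disjoint) (use not_incr_and_decr in auto)
    then show "real (card (?B x)) = real (lam V t x)"
      by (simp add: lam Int_Un_distrib2)
  qed
  have meas_lam: "(\<lambda>x. real (lam V t x)) \<in> borel_measurable lebesgue"
    using int_lam by (rule borel_measurable_integrable)
  have meas_B: "(\<lambda>x. real (card (?B x))) \<in> borel_measurable lebesgue"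
    by (rule borel_measurable_completion_AE[OF meas_lam]) (use card_B in eventually_elim, simp)
  have vartheta: "vartheta V t A = (LINT x:A|lebesgue. real (lam V t x))" if A: "A \<in> sets borel" for A
  proof -
    have "A \<in> sets lebesgue"
      using A by simp
    then have "(LINT x:A|lebesgue. real (card (?B x))) = (LINT x:A|lebesgue. real (lam V t x))"
      unfolding set_lebesgue_integral_def using meas_B meas_lam card_B
      by (intro integral_cong_AE borel_measurable_scaleR borel_measurable_indicator) auto
    then show ?thesis
      by (simp add: vartheta_def both[OF A])
  qed
  show ?thesis
    using fin int_ell int_lam theta vartheta by (simp add: times borel_measurable_integrable)
qed

end
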